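(* For every $SP$-poset $P$ define the series $$\mathcal{SH}(P)=\sum_{i=1}^{|P|}(-1)^{|P|-i}d_{P,i}\frac{1}{(1-x)^{i+1}},\quad dd\mathcal{SH}(P)=\sum_{i=1}^{|P|}(-1)^{|P|-i}d_{P,i}(1-x)^{i-1},\quad ldd\mathcal{SH}(P)=\sum_{i=1}^{|P|}d_{P,i}\frac{x^{i+1}}{(1-x)^{i+1}},$$ called respectively the colimit-indexing, right deck-divider and left deck-divider shuffle series. These three families have the following structure of algebras over the operad $\mathcal{SP}$ (in each case the operation $\sqcup$, respectively $\oplus$, applied to the series of $P$ and $Q$ gives the series of $P\sqcup Q$, respectively $P\oplus Q$): (1) $\{\mathcal{SH}(P)\}$: generator $\mathcal{SH}(1)=\frac{1}{(1-x)^2}$, unit $\mathcal{SH}(\varnothing)=\frac{1}{1-x}$, $\sqcup$ acts by the Hadamard product, and $\oplus$ acts by $(f,g)\mapsto f(1-x)g$. (2) $\{dd\mathcal{SH}(P)\}$: generator $dd\mathcal{SH}(1)=1$, unit $dd\mathcal{SH}(\varnothing)=\frac{1}{1-x}$, $\sqcup$ acts by $(f,g)\mapsto \psi(\psi^{-1}(f)\odot\psi^{-1}(g))$, where $\odot$ is the Hadamard product and $\psi$ is the linear change of basis $\frac{1}{(1-x)^{k+1}}\mapsto(1-x)^{k-1}$ ($k\ge 0$), and $\oplus$ acts by $(f,g)\mapsto f(1-x)g$. (3) $\{ldd\mathcal{SH}(P)\}$: generator $ldd\mathcal{SH}(1)=\frac{x^2}{(1-x)^2}$, unit $\frac{x}{1-x}$,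 $\sqcup$ acts by the Hadamard product, and $\oplus$ acts by $(f,g)\mapsto f\frac{1-x}{x}g$.
   Context: Posets are finite. $P\sqcup Q$ is the disjoint union; $P\oplus Q$ is the ordinal sum (every element of $P$ below every element of $Q$). An $SP$-poset is a poset obtained from one-point posets by finitely many applications of $\sqcup$ and $\oplus$. The operad $\mathcal{SP}$ is the operad generated by the binary operations $\sqcup$ and $\oplus$; for a series $F$, $F(1)$ denotes the series of the one-point poset. "Generator" is the series of the one-point poset; "unit" is an identity element for both binary operations. The integers $d_{P,i}$ are defined by $\Omega^\circ(P,x)=\sum_{i=1}^{|P|}d_{P,i}\binom{x}{i}$, where $\Omega^\circ(P,n)$ is the number of strict order-preserving maps from $P$ to the chain $1<\cdots<n$. The Hadamard product is the coefficientwise product of power series. *)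

theory Defs
  imports
    "HOL-Computational_Algebra.Computational_Algebra"
    "HOL-Combinatorics.Permutations"
    "HOL-Library.Infinite_Typeclass"
begin

section \<open>Series-parallel posets\<close>

text \<open>A finite poset is represented by its reflexive order relation \<open>P\<close>; its underlying set is
  \<open>Field P\<close>. The two operations below are meant for posets with disjoint underlying sets.\<close>

definition disj_union :: "'a rel \<Rightarrow> 'a rel \<Rightarrow> 'a rel"  (infixl \<open>\<squnion>\<^sub>P\<close> 65)
  where "P \<squnion>\<^sub>P Q = P \<union> Q"

definition ord_sum :: "'a rel \<Rightarrow> 'a rel \<Rightarrow> 'a rel"  (infixl \<open>\<oplus>\<^sub>P\<close> 65)
  where "P \<oplus>\<^sub>P Q = P \<union> Q \<union> Field P \<times> Field Q"

inductive SP_poset :: "'a rel \<Rightarrow> bool" where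
  point: "SP_poset {(a, a)}"
| disj_union: "SP_poset P \<Longrightarrow> SP_poset Q \<Longrightarrow> Field P \<inter> Field Q = {} \<Longrightarrow> SP_poset (P \<squnion>\<^sub>P Q)"
| ord_sum: "SP_poset P \<Longrightarrow> SP_poset Q \<Longrightarrow> Field P \<inter> Field Q = {} \<Longrightarrow> SP_poset (P \<oplus>\<^sub>P Q)"

lemma SP_poset_finite_partial_order:
  assumes "SP_poset P"
  shows "finite P \<and> P \<noteq> {} \<and> partial_order_on (Field P) P"
  using assms
proof induction
  case (point a)
  then show ?case
    by (auto simp: partial_order_on_def preorder_on_def refl_on_def trans_def antisym_def Field_def)
next
  case (disj_union P Q)
  have F: "(x, y) \<in> R \<Longrightarrow> x \<in> Field R \<and> y \<in> Field R" for x y and R :: "'a rel"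
    by (auto simp: Field_def)
  have "Field (P \<squnion>\<^sub>P Q) = Field P \<union> Field Q"
    by (auto simp: disj_union_def)
  with disj_union show ?case
    unfolding partial_order_on_def preorder_on_def refl_on_def disj_union_def trans_def antisym_def
    by (auto; blast dest: F)
next
  case (ord_sum P Q)
  have F: "(x, y) \<in> R \<Longrightarrow> x \<in> Field R \<and> y \<in> Field R" for x y and R :: "'a rel"
    by (auto simp: Field_def)
  have Fs: "Field (P \<oplus>\<^sub>P Q) = Field P \<union> Field Q"
    by (auto simp: ord_sum_def Field_def)
  have "finite (P \<oplus>\<^sub>P Q)"
    using ord_sum by (auto simp: ord_sum_def finite_Field)
  with ord_sum show ?case
    unfolding partial_order_on_def preorder_on_def refl_on_def Fs
    unfolding ord_sum_def trans_def antisym_def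
    by (auto; blast dest: F)
qed


section \<open>The strict order polynomial and the numbers \<open>d_{P,i}\<close>\<close>

definition strict_maps :: "'a rel \<Rightarrow> nat \<Rightarrow> ('a \<Rightarrow> nat) set" where
  "strict_maps P n =
     {f \<in> Field P \<rightarrow>\<^sub>E {1..n}. \<forall>(x, y) \<in> P. x \<noteq> y \<longrightarrow> f x < f y}"

definition Omega_strict :: "'a rel \<Rightarrow> nat \<Rightarrow> nat" where
  "Omega_strict P n = card (strict_maps P n)"

definition d_coeff :: "'a rel \<Rightarrow> nat \<Rightarrow> int" where
  "d_coeff P = (THE d.
     (\<forall>i. i \<notin> {1..card (Field P)} \<longrightarrow> d i = 0) \<and>
     (\<forall>n. int (Omega_strict P n) = (\<Sum>i = 1..card (Field P). d i * int (n choose i))))"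


section \<open>The three shuffle series\<close>

text \<open>For the empty poset the defining sums are empty (and \<open>d_coeff {}\<close> is unspecified); its
  series is by convention the unit.\<close>

definition SH :: "'a rel \<Rightarrow> rat fps" where
  "SH P = (if P = {} then 1 / (1 - fps_X) else
     (\<Sum>i = 1..card (Field P).
        (-1) ^ (card (Field P) - i) * of_int (d_coeff P i) * (1 / (1 - fps_X) ^ (i + 1))))"

definition ddSH :: "'a rel \<Rightarrow> rat fps" where
  "ddSH P = (if P = {} then 1 / (1 - fps_X) else
     (\<Sum>i = 1..card (Field P).
        (-1) ^ (card (Field P) - i) * of_int (d_coeff P i) * (1 - fps_X) ^ (i - 1)))"

definition lddSH :: "'a rel \<Rightarrow> rat fps" where
  "lddSH P = (if P = {} then fps_X / (1 - fps_X) else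
     (\<Sum>i = 1..card (Field P).
        of_int (d_coeff P i) * (fps_X ^ (i + 1) / (1 - fps_X) ^ (i + 1))))"


section \<open>Operations on series\<close>

definition hadamard :: "'a::times fps \<Rightarrow> 'a fps \<Rightarrow> 'a fps"  (infixl \<open>\<odot>\<close> 70)
  where "f \<odot> g = Abs_fps (\<lambda>n. fps_nth f n * fps_nth g n)"

definition SH_basis :: "nat \<Rightarrow> rat fps" where
  "SH_basis k = 1 / (1 - fps_X) ^ (k + 1)"

definition ddSH_basis :: "nat \<Rightarrow> rat fps" where
  "ddSH_basis k = (1 - fps_X) powi (int k - 1)"

text \<open>The finite linear combination of the family \<open>b\<close> whose coordinate vector is the
  (finitely supported) coefficient sequence of \<open>p\<close>.\<close>

definition lincomb :: "(nat \<Rightarrow> rat fps) \<Rightarrow> rat poly \<Rightarrow> rat fps" where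
  "lincomb b p = (\<Sum>k\<le>degree p. fps_const (coeff p k) * b k)"

text \<open>The change of basis is only meaningful on the span of \<open>SH_basis\<close>, and its inverse on the span
  of \<open>ddSH_basis\<close>.\<close>

definition psi :: "rat fps \<Rightarrow> rat fps" where
  "psi f = lincomb ddSH_basis (inv (lincomb SH_basis) f)"

definition psi_inv :: "rat fps \<Rightarrow> rat fps" where
  "psi_inv = inv_into (range (lincomb SH_basis)) psi"

definition SH_ord :: "rat fps \<Rightarrow> rat fps \<Rightarrow> rat fps" where
  "SH_ord f g = f * (1 - fps_X) * g"

definition ddSH_disj :: "rat fps \<Rightarrow> rat fps \<Rightarrow> rat fps" where
  "ddSH_disj f g = psi (psi_inv f \<odot> psi_inv g)"

text \<open>Division by \<open>fps_X\<close> truncates in general, but is exact here: see the lemma below, and note that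
  all \<open>lddSH\<close> series have zero constant term.\<close>

definition lddSH_ord :: "rat fps \<Rightarrow> rat fps \<Rightarrow> rat fps" where
  "lddSH_ord f g = f * (1 - fps_X) * g / fps_X"

lemma lddSH_ord_exact:
  assumes "fps_nth f 0 = 0"
  shows "fps_X * lddSH_ord f g = f * (1 - fps_X) * g"
proof -
  define h where "h = f * (1 - fps_X) * g"
  have "fps_nth h 0 = 0"
    using assms by (simp add: h_def)
  then have "fps_X * fps_shift 1 h = h"
    by (intro fps_ext) (simp add: fps_X_mult_nth)
  then show ?thesis
    by (simp add: lddSH_ord_def h_def)
qed


section \<open>The operad \<open>SP\<close> and its algebras\<close>

text \<open>An \<open>n\<close>-ary operation of the operad of finite posets is a partial order on \<open>{..<n}\<close>. Composition
  is substitution (lexicographic sum): \<open>op_comp \<theta> \<theta>s\<close> replaces the point \<open>i\<close> of \<open>\<theta>\<close> by the poset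
  \<open>\<theta>s ! i\<close>, the labels of the latter being shifted by the sizes of the previous ones. The symmetric
  group acts by relabelling. \<open>SP_operad\<close> is generated in it by the two binary operations: the
  two-point antichain, which is the operation disjoint union, and the two-point chain, which is the
  operation ordinal sum.\<close>

definition arity :: "nat rel \<Rightarrow> nat" where
  "arity \<theta> = card (Field \<theta>)"

definition op_id :: "nat rel" where
  "op_id = {(0, 0)}"

definition op_disj :: "nat rel" where
  "op_disj = {(0, 0), (1, 1)}"

definition op_ord :: "nat rel" where
  "op_ord = {(0, 0), (1, 1), (0, 1)}"

definition op_offset :: "nat rel list \<Rightarrow> nat \<Rightarrow> nat" where
  "op_offset \<theta>s i = sum_list (map arity (take i \<theta>s))"

definition op_comp :: "nat rel \<Rightarrow> nat rel list \<Rightarrow> nat rel" where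
  "op_comp \<theta> \<theta>s =
     {(op_offset \<theta>s i + a, op_offset \<theta>s j + b) | i j a b.
        i < length \<theta>s \<and> j < length \<theta>s \<and> a \<in> Field (\<theta>s ! i) \<and> b \<in> Field (\<theta>s ! j) \<and>
        (if i = j then (a, b) \<in> \<theta>s ! i else (i, j) \<in> \<theta>)}"

definition op_relabel :: "(nat \<Rightarrow> nat) \<Rightarrow> nat rel \<Rightarrow> nat rel" where
  "op_relabel \<sigma> \<theta> = {(\<sigma> a, \<sigma> b) | a b. (a, b) \<in> \<theta>}"

inductive_set SP_operad :: "nat rel set" where
  op_id: "op_id \<in> SP_operad"
| op_disj: "op_disj \<in> SP_operad"
| op_ord: "op_ord \<in> SP_operad"
| op_comp: "\<theta> \<in> SP_operad \<Longrightarrow> length \<theta>s = arity \<theta> \<Longrightarrow> (\<And>\<eta>. \<eta> \<in> set \<theta>s \<Longrightarrow> \<eta> \<in> SP_operad)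
    \<Longrightarrow> op_comp \<theta> \<theta>s \<in> SP_operad"
| op_relabel: "\<theta> \<in> SP_operad \<Longrightarrow> \<sigma> permutes {..<arity \<theta>} \<Longrightarrow> op_relabel \<sigma> \<theta> \<in> SP_operad"

text \<open>\<open>\<alpha> \<theta> xs\<close> is the value of the operation \<open>\<theta>\<close> at the \<open>arity \<theta>\<close> arguments \<open>xs\<close>. The clauses are
  closure, identity, compatibility with composition, and equivariance; in the latter the point \<open>i\<close>
  of \<open>\<theta>\<close> has label \<open>\<sigma> i\<close> in \<open>op_relabel \<sigma> \<theta>\<close> and hence receives the argument \<open>xs ! \<sigma> i\<close>.\<close>

definition SP_algebra :: "'x set \<Rightarrow> (nat rel \<Rightarrow> 'x list \<Rightarrow> 'x) \<Rightarrow> bool" where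
  "SP_algebra A \<alpha> \<longleftrightarrow>
     (\<forall>\<theta> \<in> SP_operad. \<forall>xs. length xs = arity \<theta> \<longrightarrow> set xs \<subseteq> A \<longrightarrow> \<alpha> \<theta> xs \<in> A) \<and>
     (\<forall>x \<in> A. \<alpha> op_id [x] = x) \<and>
     (\<forall>\<theta> \<in> SP_operad. \<forall>\<theta>s xss.
        length \<theta>s = arity \<theta> \<longrightarrow> set \<theta>s \<subseteq> SP_operad \<longrightarrow>
        map length xss = map arity \<theta>s \<longrightarrow> (\<forall>xs \<in> set xss. set xs \<subseteq> A) \<longrightarrow>
        \<alpha> (op_comp \<theta> \<theta>s) (concat xss) = \<alpha> \<theta> (map2 \<alpha> \<theta>s xss)) \<and>
     (\<forall>\<theta> \<in> SP_operad. \<forall>\<sigma> xs.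
        \<sigma> permutes {..<arity \<theta>} \<longrightarrow> length xs = arity \<theta> \<longrightarrow> set xs \<subseteq> A \<longrightarrow>
        \<alpha> (op_relabel \<sigma> \<theta>) xs = \<alpha> \<theta> (permute_list \<sigma> xs))"

text \<open>The family of series \<open>F P\<close>, together with the series of the empty poset, is an algebra over the
  operad in which disjoint union and ordinal sum act by \<open>dis\<close> and \<open>ord\<close>, with the given generator and
  unit. Any infinite type of points contains disjoint copies of any two finite posets.\<close>

definition SP_series_algebra ::
  "('a::infinite rel \<Rightarrow> 'x) \<Rightarrow> 'x \<Rightarrow> 'x \<Rightarrow> ('x \<Rightarrow> 'x \<Rightarrow> 'x) \<Rightarrow> ('x \<Rightarrow> 'x \<Rightarrow> 'x) \<Rightarrow> bool" where
  "SP_series_algebra F gen u dis ord \<longleftrightarrow>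
     (let A = insert (F {}) {F P | P. SP_poset P} in
       (\<exists>\<alpha>. SP_algebra A \<alpha> \<and>
          (\<forall>f \<in> A. \<forall>g \<in> A. \<alpha> op_disj [f, g] = dis f g \<and> \<alpha> op_ord [f, g] = ord f g)) \<and>
       (\<forall>P Q. SP_poset P \<longrightarrow> SP_poset Q \<longrightarrow> Field P \<inter> Field Q = {} \<longrightarrow>
          F (P \<squnion>\<^sub>P Q) = dis (F P) (F Q) \<and> F (P \<oplus>\<^sub>P Q) = ord (F P) (F Q)) \<and>
       (\<forall>a. F {(a, a)} = gen) \<and>
       F {} = u \<and>
       (\<forall>f \<in> A. dis u f = f \<and> dis f u = f \<and> ord u f = f \<and> ord f u = f))"

end

theory Submission
  imports Defs
begin

text \<open>Let an operation \<open>\<theta>\<close> act on sequences \<open>c\<^sub>i\<close> by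
    \<open>(\<theta> c) k = \<Sum>\<^sub>S \<Prod>\<^sub>i c\<^sub>i |S\<^sub>i|\<close>,
  the sum ranging over the families of subsets \<open>S\<^sub>i\<close> of a \<open>k\<close>-element chain that cover it and satisfy
  \<open>S\<^sub>i < S\<^sub>j\<close> elementwise whenever \<open>i < j\<close> in \<open>\<theta>\<close>. Grouping a cover indexed by a lexicographic sum into
  blocks shows that this action is compatible with operadic composition, and that it sends the
  numbers of strict surjections of posets to those of their composite. These numbers are the
  \<open>d\<^bsub>P,i\<^esub>\<close>. Read as coefficients of polynomials \<open>p\<close>, ordinal sum becomes the product of
  polynomials and disjoint union the pointwise product of \<open>\<Sum>\<^sub>k p\<^sub>k (x choose k)\<close>. Each of the
  three series is the image, under an injective map \<open>p \<mapsto> g \<cdot> p(w)\<close>, of the polynomial of \<open>P\<close>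
  multiplied by \<open>s\<^bsup>|P|\<^esup>\<close> with \<open>s = \<plusminus>1\<close>, so the algebra structure is transported along this map.\<close>

section \<open>Ordered covers of a chain\<close>

text \<open>Blocks may be empty, and blocks at incomparable indices may overlap. The index type is
  arbitrary, so that operations, posets and lexicographic sums can all serve as index
  orders.\<close>

definition covers :: "'i rel \<Rightarrow> nat set \<Rightarrow> ('i \<Rightarrow> nat set) set" where
  "covers \<theta> T = {S \<in> Field \<theta> \<rightarrow>\<^sub>E Pow T. (\<Union>i\<in>Field \<theta>. S i) = T \<and>
     (\<forall>i j. (i, j) \<in> \<theta> \<longrightarrow> i \<noteq> j \<longrightarrow> (\<forall>a\<in>S i. \<forall>b\<in>S j. a < b))}"

definition cover_sum :: "'i rel \<Rightarrow> ('i \<Rightarrow> nat \<Rightarrow> 'b::comm_semiring_1) \<Rightarrow> nat set \<Rightarrow> 'b" where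
  "cover_sum \<theta> c T = (\<Sum>S\<in>covers \<theta> T. \<Prod>i\<in>Field \<theta>. c i (card (S i)))"

lemma finite_covers [intro]:
  assumes "finite (Field \<theta>)" "finite T"
  shows "finite (covers \<theta> T)"
proof (rule finite_subset)
  show "covers \<theta> T \<subseteq> Field \<theta> \<rightarrow>\<^sub>E Pow T"
    by (auto simp: covers_def)
  show "finite (Field \<theta> \<rightarrow>\<^sub>E Pow T)"
    using assms by (intro finite_PiE) auto
qed

lemma covers_memI:
  assumes "S \<in> extensional (Field \<theta>)" "(\<Union>i\<in>Field \<theta>. S i) = T"
    and "\<And>i j a b. (i, j) \<in> \<theta> \<Longrightarrow> i \<noteq> j \<Longrightarrow> a \<in> S i \<Longrightarrow> b \<in> S j \<Longrightarrow> a < b"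
  shows "S \<in> covers \<theta> T"
  using assms by (auto simp: covers_def PiE_iff)

lemma coversD:
  assumes "S \<in> covers \<theta> T"
  shows "S \<in> extensional (Field \<theta>)" "(\<Union>i\<in>Field \<theta>. S i) = T"
    and "\<And>i j a b. (i, j) \<in> \<theta> \<Longrightarrow> i \<noteq> j \<Longrightarrow> a \<in> S i \<Longrightarrow> b \<in> S j \<Longrightarrow> a < b"
  using assms by (auto simp: covers_def PiE_iff)

lemma cover_sum_cong:
  assumes "\<And>i. i \<in> Field \<theta> \<Longrightarrow> c i = c' i"
  shows "cover_sum \<theta> c T = cover_sum \<theta> c' T"
  using assms by (simp add: cover_sum_def)

lemma FieldI: "(x, y) \<in> R \<Longrightarrow> x \<in> Field R" "(x, y) \<in> R \<Longrightarrow> y \<in> Field R"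
  by (auto simp: Field_def)

lemma Field_map_prod: "Field (map_prod f f ` \<theta>) = f ` Field \<theta>"
  by (force simp: Field_def)

text \<open>Precomposition with \<open>f\<close> matches the covers of the two index orders;
  injectivity keeps distinct indices distinct, and the order condition concerns only those. Serves
  for operadic relabelling, block labels and unions of posets.\<close>

lemma cover_sum_map_prod:
  assumes inj: "inj_on f (Field \<theta>)"
  shows "cover_sum (map_prod f f ` \<theta>) c T = cover_sum \<theta> (c \<circ> f) T"
  unfolding cover_sum_def Field_map_prod
proof (rule sum.reindex_bij_witness
    [where j = "\<lambda>S. restrict (S \<circ> f) (Field \<theta>)"
      and i = "\<lambda>S. restrict (S \<circ> inv_into (Field \<theta>) f) (f ` Field \<theta>)"])
  note inv [simp] = inv_into_f_f[OF inj]
  fix S assume S: "S \<in> covers (map_prod f f ` \<theta>) T"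
  note SD = coversD[OF S, unfolded Field_map_prod]
  show "restrict (restrict (S \<circ> f) (Field \<theta>) \<circ> inv_into (Field \<theta>) f) (f ` Field \<theta>) = S"
    using SD(1) by (auto simp: fun_eq_iff extensional_def restrict_def)
  show "restrict (S \<circ> f) (Field \<theta>) \<in> covers \<theta> T"
  proof (rule covers_memI)
    fix i j a b assume ij: "(i, j) \<in> \<theta>" "i \<noteq> j" and "a \<in> restrict (S \<circ> f) (Field \<theta>) i"
      "b \<in> restrict (S \<circ> f) (Field \<theta>) j"
    moreover have "f i \<noteq> f j"
      using ij inj by (auto dest: FieldI inj_onD)
    ultimately show "a < b"
      using SD(3)[of "f i" "f j" a b] by (auto simp: FieldI split: if_splits)
  qed (use SD(2) in auto)
  show "(\<Prod>i\<in>Field \<theta>. (c \<circ> f) i (card (restrict (S \<circ> f) (Field \<theta>) i))) =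
    (\<Prod>i\<in>f ` Field \<theta>. c i (card (S i)))"
    by (simp add: prod.reindex[OF inj])
next
  note inv [simp] = inv_into_f_f[OF inj]
  fix S assume S: "S \<in> covers \<theta> T"
  note SD = coversD[OF S]
  show "restrict (restrict (S \<circ> inv_into (Field \<theta>) f) (f ` Field \<theta>) \<circ> f) (Field \<theta>) = S"
    using SD(1) by (auto simp: fun_eq_iff extensional_def restrict_def)
  show "restrict (S \<circ> inv_into (Field \<theta>) f) (f ` Field \<theta>) \<in> covers (map_prod f f ` \<theta>) T"
  proof (rule covers_memI)
    fix k l a b assume "(k, l) \<in> map_prod f f ` \<theta>" "k \<noteq> l"
      "a \<in> restrict (S \<circ> inv_into (Field \<theta>) f) (f ` Field \<theta>) k"
      "b \<in> restrict (S \<circ> inv_into (Field \<theta>) f) (f ` Field \<theta>) l"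
    moreover from this obtain i j where "k = f i" "l = f j" "(i, j) \<in> \<theta>" "i \<noteq> j"
      by auto
    ultimately show "a < b"
      using SD(3)[of i j a b] by (simp add: FieldI)
  qed (use SD(2) in \<open>auto simp: Field_map_prod\<close>)
qed

text \<open>\<open>h\<close> preserves and reflects the order on \<open>U\<close> and preserves
  cardinalities, so images and preimages of blocks are mutually inverse and respect the
  summands.\<close>

lemma cover_sum_strict_mono_image:
  assumes h: "strict_mono_on U h"
  shows "cover_sum \<theta> c (h ` U) = cover_sum \<theta> c U"
  unfolding cover_sum_def
proof (rule sum.reindex_bij_witness
    [where j = "\<lambda>S. restrict (\<lambda>i. h -` S i \<inter> U) (Field \<theta>)"
      and i = "\<lambda>S. restrict (\<lambda>i. h ` S i) (Field \<theta>)"])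
  have inj: "inj_on h U"
    using h by (rule strict_mono_on_imp_inj_on)
  have less: "a < b" if "h a < h b" "a \<in> U" "b \<in> U" for a b
    using that h by (metis linorder_neqE_nat less_asym strict_mono_onD less_irrefl)
  {
    fix S assume S: "S \<in> covers \<theta> (h ` U)"
    note SD = coversD[OF S]
    have sub: "S i \<subseteq> h ` U" if "i \<in> Field \<theta>" for i
      using SD(2) that by auto
    have im: "h ` (h -` S i \<inter> U) = S i" if "i \<in> Field \<theta>" for i
      using sub[OF that] by auto
    show "restrict (\<lambda>i. h ` restrict (\<lambda>i. h -` S i \<inter> U) (Field \<theta>) i) (Field \<theta>) = S"
      using SD(1) im by (auto simp: fun_eq_iff extensional_def restrict_def)
    show "restrict (\<lambda>i. h -` S i \<inter> U) (Field \<theta>) \<in> covers \<theta> U"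
    proof (rule covers_memI)
      show "(\<Union>i\<in>Field \<theta>. restrict (\<lambda>i. h -` S i \<inter> U) (Field \<theta>) i) = U"
        using SD(2) by (auto simp flip: vimage_UN)
    qed (use SD(3) less in \<open>auto simp: FieldI\<close>)
    show "(\<Prod>i\<in>Field \<theta>. c i (card (restrict (\<lambda>i. h -` S i \<inter> U) (Field \<theta>) i))) =
      (\<Prod>i\<in>Field \<theta>. c i (card (S i)))"
    proof (rule prod.cong)
      fix i assume i: "i \<in> Field \<theta>"
      have "inj_on h (h -` S i \<inter> U)"
        using inj by (rule inj_on_subset) auto
      from card_image[OF this] show
        "c i (card (restrict (\<lambda>i. h -` S i \<inter> U) (Field \<theta>) i)) = c i (card (S i))"
        using i im by simp
    qed simp
  }
  fix S assume S: "S \<in> covers \<theta> U"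
  note SD = coversD[OF S]
  have sub: "S i \<subseteq> U" if "i \<in> Field \<theta>" for i
    using SD(2) that by auto
  have "h -` (h ` S i) \<inter> U = S i" if "i \<in> Field \<theta>" for i
    using sub[OF that] inj by (auto dest: inj_onD)
  then show "restrict (\<lambda>i. h -` restrict (\<lambda>i. h ` S i) (Field \<theta>) i \<inter> U) (Field \<theta>) = S"
    using SD(1) by (auto simp: fun_eq_iff extensional_def restrict_def)
  show "restrict (\<lambda>i. h ` S i) (Field \<theta>) \<in> covers \<theta> (h ` U)"
  proof (rule covers_memI)
    fix i j a b assume ij: "(i, j) \<in> \<theta>" "i \<noteq> j" and "a \<in> restrict (\<lambda>i. h ` S i) (Field \<theta>) i"
      "b \<in> restrict (\<lambda>i. h ` S i) (Field \<theta>) j"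
    then obtain a' b' where ab: "a = h a'" "b = h b'" "a' \<in> S i" "b' \<in> S j"
      by (auto simp: FieldI)
    then have "a' < b'" "a' \<in> U" "b' \<in> U"
      using SD(3)[OF ij] sub FieldI[OF ij(1)] by auto
    then show "a < b"
      using h ab by (auto dest: strict_mono_onD)
  qed (use SD(2) in auto)
qed

text \<open>The increasing enumeration of \<open>T\<close> is a strictly monotone bijection from
  \<open>{..<card T}\<close>. This allows cover sums to be treated as sequences indexed by the
  length of the chain.\<close>

lemma cover_sum_card:
  assumes "finite T"
  shows "cover_sum \<theta> c T = cover_sum \<theta> c {..<card T}"
proof -
  have "strict_mono_on {..<card T} (enumerate T)"
    using assms by (intro strict_mono_onI finite_enumerate_mono) auto
  moreover have "enumerate T ` {..<card T} = T"
    using finite_bij_enumerate[OF assms] by (simp add: bij_betw_def atLeast0LessThan lessThan_def)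
  ultimately show ?thesis
    by (metis cover_sum_strict_mono_image)
qed

section \<open>Block decomposition over lexicographic sums\<close>

definition lex_sum :: "'i rel \<Rightarrow> ('i \<Rightarrow> 'j rel) \<Rightarrow> ('i \<times> 'j) rel" where
  "lex_sum \<theta> \<eta> = {((i, a), (j, b)) | i a j b.
     i \<in> Field \<theta> \<and> j \<in> Field \<theta> \<and> a \<in> Field (\<eta> i) \<and> b \<in> Field (\<eta> j) \<and>
     (if i = j then (a, b) \<in> \<eta> i else (i, j) \<in> \<theta>)}"

lemma Field_lex_sum:
  assumes "\<And>i. i \<in> Field \<theta> \<Longrightarrow> Refl (\<eta> i)"
  shows "Field (lex_sum \<theta> \<eta>) = Sigma (Field \<theta>) (\<lambda>i. Field (\<eta> i))"
proof
  show "Field (lex_sum \<theta> \<eta>) \<subseteq> Sigma (Field \<theta>) (\<lambda>i. Field (\<eta> i))"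
    unfolding Field_def[of "lex_sum \<theta> \<eta>"] by (auto simp: lex_sum_def)
  have "((i, a), (i, a)) \<in> lex_sum \<theta> \<eta>" if "i \<in> Field \<theta>" "a \<in> Field (\<eta> i)" for i a
    using that assms[of i] by (auto simp: lex_sum_def refl_on_def)
  then show "Sigma (Field \<theta>) (\<lambda>i. Field (\<eta> i)) \<subseteq> Field (lex_sum \<theta> \<eta>)"
    by (auto dest: FieldI)
qed

text \<open>A cover indexed by the lexicographic sum is a cover by the unions over the blocks, together
  with a cover of each of these unions.\<close>

lemma cover_sum_lex_sum:
  fixes c :: "'i \<times> 'j \<Rightarrow> nat \<Rightarrow> 'b::comm_semiring_1"
  assumes reflx: "\<And>i. i \<in> Field \<theta> \<Longrightarrow> Refl (\<eta> i)"
    and fin: "finite (Field \<theta>)" "\<And>i. i \<in> Field \<theta> \<Longrightarrow> finite (Field (\<eta> i))" "finite T"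
  shows "cover_sum (lex_sum \<theta> \<eta>) c T =
    cover_sum \<theta> (\<lambda>i k. cover_sum (\<eta> i) (\<lambda>a. c (i, a)) {..<k}) T"
proof -
  let ?I = "Field \<theta>" and ?J = "\<lambda>i. Field (\<eta> i)"
  have F: "Field (lex_sum \<theta> \<eta>) = Sigma ?I ?J"
    using reflx by (rule Field_lex_sum)
  define B where "B S = PiE ?I (\<lambda>i. covers (\<eta> i) (S i))" for S
  have finS: "finite (S i)" if "S \<in> covers \<theta> T" "i \<in> ?I" for S i
    using coversD(2)[OF that(1)] that(2) fin(3) by (auto intro: finite_subset)
  \<comment> \<open>The inner sums over \<open>{..<k}\<close> are moved to the actual blocks
    \<open>S i\<close> of the same length.\<close>
  have "cover_sum \<theta> (\<lambda>i k. cover_sum (\<eta> i) (\<lambda>a. c (i, a)) {..<k}) T =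
    (\<Sum>S\<in>covers \<theta> T. \<Prod>i\<in>?I. cover_sum (\<eta> i) (\<lambda>a. c (i, a)) (S i))"
    unfolding cover_sum_def[of \<theta>]
    by (intro sum.cong prod.cong refl cover_sum_card[symmetric] finS)
  \<comment> \<open>By distributivity, a product of sums over inner covers is a sum over
    simultaneous choices of inner covers.\<close>
  also have "\<dots> = (\<Sum>S\<in>covers \<theta> T. \<Sum>R\<in>B S. \<Prod>i\<in>?I. \<Prod>a\<in>?J i. c (i, a) (card (R i a)))"
    unfolding cover_sum_def B_def
    by (intro sum.cong refl prod_sum_PiE fin finite_covers finS)
  also have "\<dots> = (\<Sum>S\<in>covers \<theta> T. \<Sum>R\<in>B S. \<Prod>(i, a)\<in>Sigma ?I ?J. c (i, a) (card (R i a)))"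
    using fin by (simp add: prod.Sigma)
  also have "\<dots> = (\<Sum>(S, R)\<in>Sigma (covers \<theta> T) B. \<Prod>(i, a)\<in>Sigma ?I ?J. c (i, a) (card (R i a)))"
    by (intro sum.Sigma ballI) (auto simp: B_def intro!: finite_PiE fin finite_covers finS)
  also have "\<dots> = (\<Sum>Q\<in>covers (lex_sum \<theta> \<eta>) T. \<Prod>p\<in>Sigma ?I ?J. c p (card (Q p)))"
  proof (rule sum.reindex_bij_witness
      [where i = "\<lambda>Q. (restrict (\<lambda>i. \<Union>a\<in>?J i. Q (i, a)) ?I,
            restrict (\<lambda>i. restrict (\<lambda>a. Q (i, a)) (?J i)) ?I)"
         and j = "\<lambda>(S, R). restrict (\<lambda>(i, a). R i a) (Sigma ?I ?J)"])
    fix SR assume "SR \<in> Sigma (covers \<theta> T) B"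
    then obtain S R where SR: "SR = (S, R)" and S: "S \<in> covers \<theta> T" and RB: "R \<in> B S"
      by auto
    have R: "R i \<in> covers (\<eta> i) (S i)" if "i \<in> ?I" for i
      using RB that by (auto simp: B_def)
    have RE: "R \<in> extensional ?I"
      using RB by (auto simp: B_def PiE_iff)
    note SD = coversD[OF S] and RD = coversD[OF R]
    have "restrict (\<lambda>i. \<Union>a\<in>?J i. R i a) ?I = S"
      using SD(1) RD(2) by (auto simp: fun_eq_iff extensional_def)
    moreover have "restrict (\<lambda>i. restrict (\<lambda>a. R i a) (?J i)) ?I = R"
    proof
      fix i show "restrict (\<lambda>i. restrict (\<lambda>a. R i a) (?J i)) ?I i = R i"
        using RE RD(1)[of i] by (cases "i \<in> ?I") (auto simp: extensional_restrict extensional_def)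
    qed
    moreover have "restrict (\<lambda>i. \<Union>a\<in>?J i. restrict (\<lambda>(i, a). R i a) (Sigma ?I ?J) (i, a)) ?I
        = restrict (\<lambda>i. \<Union>a\<in>?J i. R i a) ?I"
      by (auto simp: fun_eq_iff)
    moreover have "restrict (\<lambda>i. restrict (\<lambda>a. restrict (\<lambda>(i, a). R i a) (Sigma ?I ?J) (i, a)) (?J i)) ?I
        = restrict (\<lambda>i. restrict (\<lambda>a. R i a) (?J i)) ?I"
      by (auto simp: fun_eq_iff restrict_def)
    ultimately show "(restrict (\<lambda>i. \<Union>a\<in>?J i. (case SR of (S, R) \<Rightarrow>
          restrict (\<lambda>(i, a). R i a) (Sigma ?I ?J)) (i, a)) ?I,
        restrict (\<lambda>i. restrict (\<lambda>a. (case SR of (S, R) \<Rightarrow>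
          restrict (\<lambda>(i, a). R i a) (Sigma ?I ?J)) (i, a)) (?J i)) ?I) = SR"
      unfolding SR by simp
    have "restrict (\<lambda>(i, a). R i a) (Sigma ?I ?J) \<in> covers (lex_sum \<theta> \<eta>) T"
    proof (rule covers_memI)
      show "(\<Union>p\<in>Field (lex_sum \<theta> \<eta>). restrict (\<lambda>(i, a). R i a) (Sigma ?I ?J) p) = T"
      proof -
        have "(\<Union>p\<in>Sigma ?I ?J. restrict (\<lambda>(i, a). R i a) (Sigma ?I ?J) p) =
            (\<Union>i\<in>?I. \<Union>a\<in>?J i. R i a)"
          by auto
        then show ?thesis
          unfolding F using SD(2) RD(2) by simp
      qed
      fix p q x y assume pq: "(p, q) \<in> lex_sum \<theta> \<eta>" "p \<noteq> q"
        and xy: "x \<in> restrict (\<lambda>(i, a). R i a) (Sigma ?I ?J) p"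
          "y \<in> restrict (\<lambda>(i, a). R i a) (Sigma ?I ?J) q"
      from pq obtain i a j b where eq: "p = (i, a)" "q = (j, b)"
        and mem: "i \<in> ?I" "j \<in> ?I" "a \<in> ?J i" "b \<in> ?J j"
        and rel: "if i = j then (a, b) \<in> \<eta> i else (i, j) \<in> \<theta>"
        by (auto simp: lex_sum_def)
      have x: "x \<in> R i a" and y: "y \<in> R j b"
        using xy mem by (auto simp: eq)
      show "x < y"
      \<comment> \<open>Inside one block the inner cover gives the order; between two blocks the
        outer cover does, as its parts contain the inner ones.\<close>
      proof (cases "i = j")
        case True
        then show ?thesis using RD(3)[OF mem(1), of a b x y] rel x y pq(2) eq by auto
      next
        case False
        have "x \<in> S i" "y \<in> S j"
          using RD(2) mem x y by blast+
        then show ?thesis using SD(3)[of i j x y] rel False by auto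
      qed
    qed (auto simp: F)
    then show "(case SR of (S, R) \<Rightarrow> restrict (\<lambda>(i, a). R i a) (Sigma ?I ?J))
        \<in> covers (lex_sum \<theta> \<eta>) T"
      by (simp add: SR)
    show "(\<Prod>p\<in>Sigma ?I ?J. c p (card ((case SR of (S, R) \<Rightarrow>
          restrict (\<lambda>(i, a). R i a) (Sigma ?I ?J)) p))) =
        (case SR of (S, R) \<Rightarrow> \<Prod>(i, a)\<in>Sigma ?I ?J. c (i, a) (card (R i a)))"
      by (auto simp: SR intro!: prod.cong)
  next
    fix Q assume Q: "Q \<in> covers (lex_sum \<theta> \<eta>) T"
    note QD = coversD[OF Q, unfolded F]
    have "restrict (\<lambda>(i, a). restrict (\<lambda>i. restrict (\<lambda>a. Q (i, a)) (?J i)) ?I i a) (Sigma ?I ?J) = Q"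
      using QD(1) by (auto simp: fun_eq_iff extensional_def restrict_def)
    then show "(case (restrict (\<lambda>i. \<Union>a\<in>?J i. Q (i, a)) ?I,
          restrict (\<lambda>i. restrict (\<lambda>a. Q (i, a)) (?J i)) ?I) of
        (S, R) \<Rightarrow> restrict (\<lambda>(i, a). R i a) (Sigma ?I ?J)) = Q"
      by (simp only: prod.case)
    have "restrict (\<lambda>i. \<Union>a\<in>?J i. Q (i, a)) ?I \<in> covers \<theta> T"
    proof (rule covers_memI)
      show "(\<Union>i\<in>?I. restrict (\<lambda>i. \<Union>a\<in>?J i. Q (i, a)) ?I i) = T"
        using QD(2) by auto
      fix i j x y assume ij: "(i, j) \<in> \<theta>" "i \<noteq> j"
        and xy: "x \<in> restrict (\<lambda>i. \<Union>a\<in>?J i. Q (i, a)) ?I i"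
          "y \<in> restrict (\<lambda>i. \<Union>a\<in>?J i. Q (i, a)) ?I j"
      then obtain a b where ab: "a \<in> ?J i" "b \<in> ?J j" "x \<in> Q (i, a)" "y \<in> Q (j, b)"
        by (auto simp: FieldI)
      have "((i, a), (j, b)) \<in> lex_sum \<theta> \<eta>"
        using ij ab by (auto simp: lex_sum_def FieldI)
      then show "x < y"
        using QD(3) ij(2) ab by blast
    qed auto
    moreover have "restrict (\<lambda>a. Q (i, a)) (?J i) \<in> covers (\<eta> i) (\<Union>a\<in>?J i. Q (i, a))"
      if i: "i \<in> ?I" for i
    proof (rule covers_memI)
      fix a b x y assume ab: "(a, b) \<in> \<eta> i" "a \<noteq> b"
        and xy: "x \<in> restrict (\<lambda>a. Q (i, a)) (?J i) a" "y \<in> restrict (\<lambda>a. Q (i, a)) (?J i) b"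
      have "((i, a), (i, b)) \<in> lex_sum \<theta> \<eta>"
        using i ab by (auto simp: lex_sum_def FieldI)
      then show "x < y"
        using QD(3)[of "(i, a)" "(i, b)" x y] ab xy by (auto simp: FieldI)
    qed auto
    ultimately show "(restrict (\<lambda>i. \<Union>a\<in>?J i. Q (i, a)) ?I,
        restrict (\<lambda>i. restrict (\<lambda>a. Q (i, a)) (?J i)) ?I) \<in> Sigma (covers \<theta> T) B"
      by (auto simp: B_def)
  qed
  finally show ?thesis
    by (simp add: cover_sum_def F)
qed

section \<open>Cover sums over points, antichains and the two-point chain\<close>

lemma cover_sum_point: "cover_sum {(a, a)} c T = c a (card T)"
proof -
  have "covers {(a, a)} T = {\<lambda>i\<in>{a}. T}"
    by (auto simp: covers_def PiE_iff fun_eq_iff extensional_def)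
  then show ?thesis
    by (simp add: cover_sum_def)
qed

lemma cover_sum_empty: "cover_sum ({} :: 'i rel) c T = of_bool (T = {})"
proof -
  have "covers ({} :: 'i rel) T = (if T = {} then {\<lambda>_. undefined} else {})"
    by (auto simp: covers_def)
  then show ?thesis
    by (cases "T = {}") (simp_all add: cover_sum_def)
qed

lemma of_nat_cover_sum:
  "of_nat (cover_sum \<theta> c T) = cover_sum \<theta> (\<lambda>i k. of_nat (c i k)) T"
  by (simp add: cover_sum_def)

text \<open>Without strict relations the order condition is void, so a family of subsets of
  \<open>U\<close> covers its own union and nothing else. Summing over all \<open>T\<close> frees
  the family, and the product factors.\<close>

lemma sum_cover_sum_antichain:
  assumes "finite (Field \<theta>)" "finite U" "\<theta> \<subseteq> Id"
  shows "(\<Sum>T\<in>Pow U. cover_sum \<theta> c T) = (\<Prod>i\<in>Field \<theta>. \<Sum>S\<in>Pow U. c i (card S))"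
proof -
  have "(\<Union>T\<in>Pow U. covers \<theta> T) = Field \<theta> \<rightarrow>\<^sub>E Pow U"
  proof (intro equalityI subsetI)
    fix S assume "S \<in> Field \<theta> \<rightarrow>\<^sub>E Pow U"
    then have "S \<in> extensional (Field \<theta>)" "(\<Union>i\<in>Field \<theta>. S i) \<in> Pow U"
      unfolding PiE_iff by blast+
    moreover from this have "S \<in> covers \<theta> (\<Union>i\<in>Field \<theta>. S i)"
      using assms(3) by (intro covers_memI) auto
    ultimately show "S \<in> (\<Union>T\<in>Pow U. covers \<theta> T)"
      by blast
  next
    fix S assume "S \<in> (\<Union>T\<in>Pow U. covers \<theta> T)"
    then show "S \<in> Field \<theta> \<rightarrow>\<^sub>E Pow U"
      unfolding covers_def PiE_iff by blast
  qed
  moreover have "(\<Sum>T\<in>Pow U. cover_sum \<theta> c T) =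
      (\<Sum>S\<in>(\<Union>T\<in>Pow U. covers \<theta> T). \<Prod>i\<in>Field \<theta>. c i (card (S i)))"
    unfolding cover_sum_def
  proof (rule sum.UNION_disjoint[symmetric])
    show "\<forall>T\<in>Pow U. finite (covers \<theta> T)"
      using assms by (blast intro: finite_covers finite_subset)
  qed (use assms in \<open>auto simp: covers_def\<close>)
  ultimately show ?thesis
    using assms by (simp add: prod_sum_PiE)
qed

lemma sum_Pow_card:
  fixes f :: "nat \<Rightarrow> 'b::comm_semiring_1"
  assumes "finite U"
  shows "(\<Sum>T\<in>Pow U. f (card T)) = (\<Sum>k\<le>card U. of_nat (card U choose k) * f k)"
proof -
  have "(\<Sum>T\<in>Pow U. f (card T)) = (\<Sum>k\<le>card U. \<Sum>T | T \<in> Pow U \<and> card T = k. f (card T))"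
    using assms by (intro sum.group[symmetric]) (auto intro: card_mono)
  also have "\<dots> = (\<Sum>k\<le>card U. of_nat (card U choose k) * f k)"
    using n_subsets[OF assms] by (intro sum.cong refl) simp
  finally show ?thesis .
qed

text \<open>Serves to recognise the lower part of a cut of a chain as an initial segment.\<close>

lemma finite_down_closed_nat_eq:
  assumes "finite (S :: nat set)" "\<And>a b. b \<in> S \<Longrightarrow> a < b \<Longrightarrow> a \<in> S"
  shows "S = {..<card S}"
proof (cases "S = {}")
  case False
  then have "S = {..Max S}"
    using assms Max_in[OF assms(1) False] Max_ge[OF assms(1)]
    by (metis atMost_iff le_neq_implies_less subsetI subset_antisym)
  then show ?thesis
    by (metis card_atMost lessThan_Suc_atMost)
qed simp

lemma Field_op_disj: "Field op_disj = {0, 1}"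
  and Field_op_ord: "Field op_ord = {0, 1}"
  and Field_op_id: "Field op_id = {0}"
  by (auto simp: op_disj_def op_ord_def op_id_def Field_def)

text \<open>A cover by two blocks, the first entirely below the second, is a cut of the chain and is
  determined by the size of the first block. Ordinal sum therefore acts by convolution.\<close>

lemma cover_sum_op_ord:
  "cover_sum op_ord c {..<k} = (\<Sum>i\<le>k. c 0 i * c 1 (k - i))"
  unfolding cover_sum_def Field_op_ord
proof (rule sum.reindex_bij_witness
    [where j = "\<lambda>S. card (S 0)"
      and i = "\<lambda>i. \<lambda>j\<in>{0,1}. if j = 0 then {..<i} else {i..<k}"])
  fix S assume S: "S \<in> covers op_ord {..<k}"
  note SD = coversD[OF S, unfolded Field_op_ord]
  have un: "S 0 \<union> S 1 = {..<k}"
    using SD(2) by auto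
  have lt: "a < b" if "a \<in> S 0" "b \<in> S 1" for a b
    using SD(3)[of 0 1 a b] that by (auto simp: op_ord_def)
  have fin: "finite (S 0)"
    using un by (metis finite_Un finite_lessThan)
  \<comment> \<open>An element below a member of the first block cannot lie in the second.\<close>
  have S0: "S 0 = {..<card (S 0)}"
  proof (rule finite_down_closed_nat_eq)
    fix a b assume "b \<in> S 0" "a < b"
    then show "a \<in> S 0"
      using un lt[of b a] by (metis UnE UnI1 lessThan_iff less_asym less_trans)
  qed fact
  have disj: "S 0 \<inter> S 1 = {}"
    using lt by blast
  have S1: "S 1 = {card (S 0)..<k}"
  proof -
    have "S 1 = {..<k} - S 0"
      using un disj by auto
    also have "\<dots> = {..<k} - {..<card (S 0)}"
      using S0 by simp
    finally show ?thesis
      by auto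
  qed
  show "(\<lambda>j\<in>{0,1}. if j = 0 then {..<card (S 0)} else {card (S 0)..<k}) = S"
    using SD(1) S0 S1 by (auto simp: fun_eq_iff extensional_def restrict_def)
  have "card (S 0) \<le> card {..<k}"
    using un by (intro card_mono) auto
  then show "card (S 0) \<in> {..k}"
    by simp
  have "card (S 1) = k - card (S 0)"
    by (subst S1) simp
  then show "c 0 (card (S 0)) * c 1 (k - card (S 0)) = (\<Prod>i\<in>{0, 1}. c i (card (S i)))"
    by simp
next
  fix i assume "i \<in> {..k}"
  then show "(\<lambda>j\<in>{0,1}. if j = 0 then {..<i} else {i..<k}) \<in> covers op_ord {..<k}"
    by (intro covers_memI) (auto simp: Field_op_ord op_ord_def)
qed auto

section \<open>Counting strict surjections\<close>

text \<open>A strict map is encoded as the cover of its image by singletons.\<close>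

definition surj_count :: "'a rel \<Rightarrow> nat \<Rightarrow> nat" where
  "surj_count P k = cover_sum P (\<lambda>_ k. of_bool (k = 1)) {..<k}"

lemma prod_of_bool:
  assumes "finite A"
  shows "(\<Prod>i\<in>A. of_bool (Q i)) = (of_bool (\<forall>i\<in>A. Q i) :: 'b::comm_semiring_1)"
  using assms by induction auto

text \<open>The product of indicators retains exactly the covers by singletons \<open>{f i}\<close>;
  for these, covering \<open>T\<close> means that \<open>f\<close> is onto and the order condition
  means that it is strict.\<close>

lemma card_strict_surj:
  fixes T :: "nat set"
  assumes fin: "finite (Field P)" "finite T"
  shows "card {f \<in> Field P \<rightarrow>\<^sub>E T. f ` Field P = T \<and> (\<forall>(x, y)\<in>P. x \<noteq> y \<longrightarrow> f x < f y)} =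
    surj_count P (card T)" (is "card ?A = _")
proof -
  have "surj_count P (card T) = cover_sum P (\<lambda>_ k. of_bool (k = 1)) T"
    unfolding surj_count_def by (rule cover_sum_card[symmetric]) fact
  also have "\<dots> = (\<Sum>S\<in>covers P T. of_bool (\<forall>i\<in>Field P. card (S i) = 1))"
    unfolding cover_sum_def
    by (simp add: prod_of_bool fin)
  also have "\<dots> = card {S \<in> covers P T. \<forall>i\<in>Field P. card (S i) = 1}"
    using finite_covers[OF fin] by (simp add: sum.If_cases of_bool_def Int_def)
  also have "\<dots> = card ?A"
  proof (rule bij_betw_same_card[symmetric])
    show "bij_betw (\<lambda>f. \<lambda>i\<in>Field P. {f i}) ?A {S \<in> covers P T. \<forall>i\<in>Field P. card (S i) = 1}"
    proof (rule bij_betw_byWitness[where f' = "\<lambda>S. \<lambda>i\<in>Field P. the_elem (S i)"])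
      show "\<forall>f\<in>?A. (\<lambda>i\<in>Field P. the_elem ((\<lambda>i\<in>Field P. {f i}) i)) = f"
        by (auto simp: fun_eq_iff PiE_iff extensional_def)
      show "\<forall>S\<in>{S \<in> covers P T. \<forall>i\<in>Field P. card (S i) = 1}.
          (\<lambda>i\<in>Field P. {(\<lambda>i\<in>Field P. the_elem (S i)) i}) = S"
        by (auto simp: fun_eq_iff covers_def PiE_iff extensional_def card_1_singleton_iff)
      show "(\<lambda>f. \<lambda>i\<in>Field P. {f i}) ` ?A \<subseteq> {S \<in> covers P T. \<forall>i\<in>Field P. card (S i) = 1}"
        by (auto intro!: covers_memI simp: FieldI)
      show "(\<lambda>S. \<lambda>i\<in>Field P. the_elem (S i)) `
          {S \<in> covers P T. \<forall>i\<in>Field P. card (S i) = 1} \<subseteq> ?A"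
      proof
        fix f assume "f \<in> (\<lambda>S. \<lambda>i\<in>Field P. the_elem (S i)) `
          {S \<in> covers P T. \<forall>i\<in>Field P. card (S i) = 1}"
        then obtain S where S: "S \<in> covers P T" and 1: "\<And>i. i \<in> Field P \<Longrightarrow> card (S i) = 1"
          and f: "f = (\<lambda>i\<in>Field P. the_elem (S i))"
          by auto
        note SD = coversD[OF S]
        have Sf: "S i = {f i}" if "i \<in> Field P" for i
          by (rule card_1_singletonE[OF 1[OF that]]) (simp add: f that)
        then have "f ` Field P = T"
          using SD(2) by auto
        moreover have "f x < f y" if "(x, y) \<in> P" "x \<noteq> y" for x y
          using SD(3)[OF that, of "f x" "f y"] Sf FieldI[OF that(1)] by auto
        moreover have "f \<in> extensional (Field P)"
          using f by simp
        ultimately show "f \<in> ?A"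
          by (auto simp: PiE_iff)
      qed
    qed
  qed
  finally show ?thesis
    by simp
qed

text \<open>A strict map is a strict surjection onto its image, and the number of these depends only
  on the size of the image. This is the expansion that characterises \<open>d_coeff\<close>.\<close>

lemma Omega_strict_eq_sum:
  assumes fin: "finite (Field P)"
  shows "Omega_strict P n = (\<Sum>k\<le>n. (n choose k) * surj_count P k)"
proof -
  let ?A = "\<lambda>T. {f \<in> Field P \<rightarrow>\<^sub>E T. f ` Field P = T \<and> (\<forall>(x, y)\<in>P. x \<noteq> y \<longrightarrow> f x < f y)}"
  have "strict_maps P n = (\<Union>T\<in>Pow {1..n}. ?A T)"
    by (auto simp: strict_maps_def)
  then have "Omega_strict P n = card (\<Union>T\<in>Pow {1..n}. ?A T)"
    by (simp add: Omega_strict_def)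
  also have "\<dots> = (\<Sum>T\<in>Pow {1..n}. card (?A T))"
  proof (rule card_UN_disjoint)
    show "\<forall>T\<in>Pow {1..n}. finite (?A T)"
      using fin by (auto intro!: finite_subset[OF _ finite_PiE[of "Field P" "\<lambda>_. {1..n}"]])
  qed auto
  also have "\<dots> = (\<Sum>T\<in>Pow {1..n}. surj_count P (card T))"
    by (intro sum.cong refl card_strict_surj fin) (auto intro: finite_subset)
  finally show ?thesis
    by (simp add: sum_Pow_card)
qed

lemma surj_count_eq_0:
  assumes "finite (Field P)" "card (Field P) < k"
  shows "surj_count P k = 0"
proof -
  have "\<not> (f ` Field P = {..<k})" for f
    using card_image_le[OF assms(1), of f] assms(2) by auto
  then show ?thesis
    using card_strict_surj[OF assms(1), of "{..<k}"] by simp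
qed

text \<open>Only the empty poset maps onto the empty set.\<close>

lemma surj_count_0:
  assumes "finite (Field P)" "P \<noteq> {}"
  shows "surj_count P 0 = 0"
proof -
  have "Field P \<noteq> {}"
    using assms(2) by (auto simp: Field_def)
  then show ?thesis
    using card_strict_surj[OF assms(1), of "{}"] by simp
qed

lemma surj_count_point: "surj_count {(a, a)} k = of_bool (k = 1)"
  by (simp add: surj_count_def cover_sum_point)

lemma surj_count_empty: "surj_count {} k = of_bool (k = 0)"
  by (auto simp: surj_count_def cover_sum_empty lessThan_empty_iff)

text \<open>The system is triangular: at argument \<open>n\<close> the binomials of index above
  \<open>n\<close> vanish and that of index \<open>n\<close> is 1, so the earlier entries determine
  \<open>d n\<close>.\<close>

lemma binomial_coeffs_unique:
  fixes d d' :: "nat \<Rightarrow> int"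
  assumes "\<And>i. i \<notin> {1..N} \<Longrightarrow> d i = 0" "\<And>i. i \<notin> {1..N} \<Longrightarrow> d' i = 0"
    and "\<And>n. (\<Sum>i = 1..N. d i * int (n choose i)) = (\<Sum>i = 1..N. d' i * int (n choose i))"
  shows "d = d'"
proof
  fix n show "d n = d' n"
  proof (induction n rule: less_induct)
    case (less n)
    have eq: "(\<Sum>i = 1..N. e i * int (n choose i)) = e n + (\<Sum>i<n. e i * int (n choose i))"
      if "\<And>i. i \<notin> {1..N} \<Longrightarrow> e i = 0" for e
    proof -
      have "(\<Sum>i = 1..N. e i * int (n choose i)) = (\<Sum>i\<in>{1..N} \<union> {..n}. e i * int (n choose i))"
        by (intro sum.mono_neutral_left) (use that in auto)
      also have "\<dots> = (\<Sum>i\<le>n. e i * int (n choose i))"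
        by (intro sum.mono_neutral_right) auto
      finally show ?thesis
        by (simp add: lessThan_Suc_atMost[symmetric])
    qed
    show ?case
      using eq[of d] eq[of d'] assms less by simp
  qed
qed

text \<open>Surjection counts have the defining property, and uniqueness resolves the
  \<open>THE\<close>. The defining sum starts at 1, in accordance with the vanishing of
  \<open>surj_count P 0\<close> for nonempty \<open>P\<close>.\<close>

lemma d_coeff_eq_surj_count:
  assumes fin: "finite (Field P)" and ne: "P \<noteq> {}"
  shows "d_coeff P = (\<lambda>i. int (surj_count P i))"
  unfolding d_coeff_def
proof (rule the_equality)
  have supp: "surj_count P i = 0" if "i \<notin> {1..card (Field P)}" for i
    using that surj_count_0[OF assms] surj_count_eq_0[OF fin, of i] by (cases "i = 0") auto
  have eq: "int (Omega_strict P n) =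
      (\<Sum>i = 1..card (Field P). int (surj_count P i) * int (n choose i))" for n
  proof -
    \<comment> \<open>The two ranges are compared through their union: \<open>n choose i\<close>
      vanishes beyond \<open>n\<close>, and \<open>surj_count P i\<close> outside the second
      range.\<close>
    have "Omega_strict P n = (\<Sum>i\<in>{..n} \<union> {1..card (Field P)}. surj_count P i * (n choose i))"
      unfolding Omega_strict_eq_sum[OF fin] mult.commute[of "n choose _"]
      by (intro sum.mono_neutral_left) auto
    also have "\<dots> = (\<Sum>i = 1..card (Field P). surj_count P i * (n choose i))"
      by (intro sum.mono_neutral_right) (use supp in auto)
    finally show ?thesis
      by simp
  qed
  show "(\<forall>i. i \<notin> {1..card (Field P)} \<longrightarrow> int (surj_count P i) = 0) \<and>
    (\<forall>n. int (Omega_strict P n) =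
      (\<Sum>i = 1..card (Field P). int (surj_count P i) * int (n choose i)))"
    using supp eq by simp
  fix d assume "(\<forall>i. i \<notin> {1..card (Field P)} \<longrightarrow> d i = 0) \<and>
    (\<forall>n. int (Omega_strict P n) = (\<Sum>i = 1..card (Field P). d i * int (n choose i)))"
  then show "d = (\<lambda>i. int (surj_count P i))"
    using supp eq by (intro binomial_coeffs_unique[of "card (Field P)"]) auto
qed

text \<open>Both posets are lexicographic sums over a two-point order with the pairs projected by
  \<open>snd\<close>, which is injective there since the fields are disjoint. The block
  decomposition then applies with indicator weights.\<close>

lemma surj_count_binary:
  assumes fin: "finite (Field P)" "finite (Field Q)" and reflx: "Refl P" "Refl Q"
    and disj: "Field P \<inter> Field Q = {}"
  shows "surj_count (P \<squnion>\<^sub>P Q) k = cover_sum op_disj (\<lambda>i. surj_count (if i = 0 then P else Q)) {..<k}"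
    and "surj_count (P \<oplus>\<^sub>P Q) k = cover_sum op_ord (\<lambda>i. surj_count (if i = 0 then P else Q)) {..<k}"
proof -
  define \<eta> where "\<eta> i = (if i = 0 then P else Q)" for i :: nat
  have R: "Refl (\<eta> i)" and f: "finite (Field (\<eta> i))" for i
    using reflx fin by (simp_all add: \<eta>_def)
  have *: "surj_count (map_prod snd snd ` lex_sum \<theta> \<eta>) k =
      cover_sum \<theta> (\<lambda>i. surj_count (\<eta> i)) {..<k}" if "Field \<theta> = {0, 1}" for \<theta> :: "nat rel"
  proof -
    have "inj_on snd (Field (lex_sum \<theta> \<eta>))"
      using disj unfolding Field_lex_sum[OF R] that by (auto simp: inj_on_def \<eta>_def)
    then show ?thesis
      unfolding surj_count_def
      by (subst cover_sum_map_prod) (simp_all add: comp_def cover_sum_lex_sum R f that)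
  qed
  have mem: "(x, y) \<in> map_prod snd snd ` lex_sum \<theta> \<eta> \<longleftrightarrow>
      (\<exists>i\<in>Field \<theta>. \<exists>j\<in>Field \<theta>. x \<in> Field (\<eta> i) \<and> y \<in> Field (\<eta> j) \<and>
        (if i = j then (x, y) \<in> \<eta> i else (i, j) \<in> \<theta>))" for x y and \<theta> :: "nat rel"
    unfolding lex_sum_def image_iff Bex_def by auto
  have "(x, y) \<in> map_prod snd snd ` lex_sum op_disj \<eta> \<longleftrightarrow> (x, y) \<in> P \<squnion>\<^sub>P Q" for x y
    unfolding mem Field_op_disj disj_union_def
    by (auto simp: \<eta>_def op_disj_def FieldI)
  then have "map_prod snd snd ` lex_sum op_disj \<eta> = P \<squnion>\<^sub>P Q"
    by (intro set_eqI) (simp only: split_paired_all)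
  with *[OF Field_op_disj]
  show "surj_count (P \<squnion>\<^sub>P Q) k =
      cover_sum op_disj (\<lambda>i. surj_count (if i = 0 then P else Q)) {..<k}"
    by (simp add: \<eta>_def)
  have "(x, y) \<in> map_prod snd snd ` lex_sum op_ord \<eta> \<longleftrightarrow> (x, y) \<in> P \<oplus>\<^sub>P Q" for x y
    unfolding mem Field_op_ord ord_sum_def
    by (auto simp: \<eta>_def op_ord_def FieldI)
  then have "map_prod snd snd ` lex_sum op_ord \<eta> = P \<oplus>\<^sub>P Q"
    by (intro set_eqI) (simp only: split_paired_all)
  with *[OF Field_op_ord]
  show "surj_count (P \<oplus>\<^sub>P Q) k =
      cover_sum op_ord (\<lambda>i. surj_count (if i = 0 then P else Q)) {..<k}"
    by (simp add: \<eta>_def)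
qed

section \<open>The action of the operad on sequences\<close>

definition seq_op :: "nat rel \<Rightarrow> (nat \<Rightarrow> 'b::comm_semiring_1) list \<Rightarrow> nat \<Rightarrow> 'b" where
  "seq_op \<theta> cs k = cover_sum \<theta> (\<lambda>i. cs ! i) {..<k}"

section \<open>Consecutive labels of a composite\<close>

lemma inj_on_block_position:
  fixes ns :: "nat list"
  shows
  "inj_on (\<lambda>(i, a). sum_list (take i ns) + a) (Sigma {..<length ns} (\<lambda>i. {..<ns ! i}))"
    (is "inj_on ?f ?D")
proof -
  have less: "sum_list (take i ns) + a < sum_list (take j ns) + b"
    if "i < j" "j < length ns" "a < ns ! i" for i j a b
  proof -
    have "sum_list (take i ns) + a < sum_list (take (Suc i) ns)"
      using that by (simp add: take_Suc_conv_app_nth)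
    also have "\<dots> \<le> sum_list (take j ns)"
      using that by (metis Suc_leI le_Suc_ex le_add1 sum_list_append take_add)
    finally show ?thesis
      by simp
  qed
  show ?thesis
  proof (rule inj_onI)
    fix p q assume pq: "p \<in> ?D" "q \<in> ?D" "?f p = ?f q"
    then show "p = q"
      using less[of "fst p" "fst q" "snd p" "snd q"] less[of "fst q" "fst p" "snd q" "snd p"]
      by (cases "fst p" "fst q" rule: linorder_cases) (auto split: prod.splits)
  qed
qed

lemma image_block_position:
  fixes ns :: "nat list"
  shows
  "(\<lambda>(i, a). sum_list (take i ns) + a) ` (Sigma {..<length ns} (\<lambda>i. {..<ns ! i})) =
    {..<sum_list ns}"
proof (induction ns)
  case (Cons n ns)
  \<comment> \<open>The pairs split into the first block and those of the remaining list with block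
    index raised by one; the positions of the latter are shifted by \<open>n\<close>.\<close>
  have "Sigma {..<length (n # ns)} (\<lambda>i. {..<(n # ns) ! i}) =
      Pair 0 ` {..<n} \<union> map_prod Suc id ` Sigma {..<length ns} (\<lambda>i. {..<ns ! i})"
    (is "?L = ?R")
  proof (intro set_eqI)
    fix p show "p \<in> ?L \<longleftrightarrow> p \<in> ?R"
      by (cases p; cases "fst p") (force simp: image_iff)+
  qed
  then have "(\<lambda>(i, a). sum_list (take i (n # ns)) + a) ` ?L =
      {..<n} \<union> (+) n ` ((\<lambda>(i, a). sum_list (take i ns) + a) `
        (Sigma {..<length ns} (\<lambda>i. {..<ns ! i})))"
    by (simp add: image_Un image_image case_prod_unfold add.assoc)
  also have "\<dots> = {..<sum_list (n # ns)}"
    unfolding Cons.IH by (simp add: lessThan_atLeast0 image_add_atLeastLessThan ivl_disj_un add.commute)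
  finally show ?case .
qed simp

lemma nth_concat_block_position:
  assumes "i < length xss" "a < length (xss ! i)"
  shows "concat xss ! (sum_list (take i (map length xss)) + a) = xss ! i ! a"
  using assms
proof (induction xss arbitrary: i)
  case (Cons xs xss)
  then show ?case
    by (cases i) (simp_all add: nth_append add.assoc)
qed simp

text \<open>Distributes the arguments of a composite over the operations substituted into
  it.\<close>

lemma concat_split_exists:
  assumes "length xs = sum_list ns"
  shows "\<exists>xss. map length xss = ns \<and> concat xss = xs"
  using assms
proof (induction ns arbitrary: xs)
  case (Cons n ns)
  then obtain xss where "map length xss = ns" "concat xss = drop n xs"
    by (metis add_diff_cancel_left' length_drop sum_list.Cons)
  then show ?case
    using Cons.prems by (intro exI[of _ "take n xs # xss"]) simp
qed simp

definition block_position :: "nat rel list \<Rightarrow> nat \<times> nat \<Rightarrow> nat" where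
  "block_position \<theta>s = (\<lambda>(i, a). sum_list (take i (map arity \<theta>s)) + a)"

text \<open>Exhibits operadic substitution as a relabelled lexicographic sum, to which the block
  decomposition applies. \<open>lex_sum\<close> keeps block and point apart as a pair;
  \<open>block_position\<close> supplies the consecutive labels.\<close>

lemma op_comp_eq_lex_sum:
  assumes "Field \<theta> = {..<length \<theta>s}"
  shows "op_comp \<theta> \<theta>s =
    map_prod (block_position \<theta>s) (block_position \<theta>s) ` lex_sum \<theta> ((!) \<theta>s)"
    (is "_ = map_prod ?f ?f ` ?L")
proof (intro equalityI subsetI)
  fix z assume "z \<in> op_comp \<theta> \<theta>s"
  then obtain i j a b where z: "z = (op_offset \<theta>s i + a, op_offset \<theta>s j + b)"
    and "i < length \<theta>s \<and> j < length \<theta>s \<and> a \<in> Field (\<theta>s ! i) \<and> b \<in> Field (\<theta>s ! j) \<and>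
        (if i = j then (a, b) \<in> \<theta>s ! i else (i, j) \<in> \<theta>)"
    unfolding op_comp_def by blast
  then have "((i, a), (j, b)) \<in> ?L"
    by (auto simp: lex_sum_def assms)
  then have "map_prod ?f ?f ((i, a), (j, b)) \<in> map_prod ?f ?f ` ?L"
    by (rule imageI)
  then show "z \<in> map_prod ?f ?f ` ?L"
    by (simp add: z block_position_def op_offset_def take_map)
next
  fix z assume "z \<in> map_prod ?f ?f ` ?L"
  then obtain w where w: "z = map_prod ?f ?f w" "w \<in> ?L"
    by (rule imageE)
  from w(2) obtain i a j b where ij: "w = ((i, a), (j, b))"
    and "i \<in> Field \<theta> \<and> j \<in> Field \<theta> \<and> a \<in> Field (\<theta>s ! i) \<and> b \<in> Field (\<theta>s ! j) \<and>
        (if i = j then (a, b) \<in> \<theta>s ! i else (i, j) \<in> \<theta>)"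
    unfolding lex_sum_def by blast
  then have "i < length \<theta>s \<and> j < length \<theta>s \<and> a \<in> Field (\<theta>s ! i) \<and> b \<in> Field (\<theta>s ! j) \<and>
        (if i = j then (a, b) \<in> \<theta>s ! i else (i, j) \<in> \<theta>)"
    unfolding assms lessThan_iff by blast
  moreover have "z = (op_offset \<theta>s i + a, op_offset \<theta>s j + b)"
    by (simp add: w(1) ij block_position_def op_offset_def take_map)
  ultimately show "z \<in> op_comp \<theta> \<theta>s"
    unfolding op_comp_def by blast
qed

text \<open>The invariant of \<open>SP_operad\<close> that substitution and cover sums rely on:
  labels form an initial segment, and reflexivity keeps every point in the field of a lexicographic
  sum.\<close>

definition operation :: "nat rel \<Rightarrow> bool" where
  "operation \<theta> \<longleftrightarrow> Field \<theta> = {..<arity \<theta>} \<and> Refl \<theta>"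

lemma operationD:
  assumes "operation \<theta>"
  shows "Field \<theta> = {..<arity \<theta>}" "Refl \<theta>"
  using assms unfolding operation_def by blast+

lemma operationI:
  assumes "Field \<theta> = {..<n}" "\<And>i. i < n \<Longrightarrow> (i, i) \<in> \<theta>"
  shows "operation \<theta>"
  using assms by (auto simp: operation_def arity_def refl_on_def)

lemma Field_lex_sum_nth:
  assumes "Field \<theta> = {..<length \<theta>s}" "\<And>\<eta>. \<eta> \<in> set \<theta>s \<Longrightarrow> operation \<eta>"
  shows "Field (lex_sum \<theta> ((!) \<theta>s)) =
    Sigma {..<length (map arity \<theta>s)} (\<lambda>i. {..<map arity \<theta>s ! i})"
proof -
  have "Refl (\<theta>s ! i)" if "i \<in> Field \<theta>" for i
    using that assms by (intro operationD(2)) simp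
  then have "Field (lex_sum \<theta> ((!) \<theta>s)) = Sigma (Field \<theta>) (\<lambda>i. Field (\<theta>s ! i))"
    by (rule Field_lex_sum)
  also have "\<dots> = Sigma {..<length (map arity \<theta>s)} (\<lambda>i. {..<map arity \<theta>s ! i})"
    using assms operationD(1) by (intro Sigma_cong) auto
  finally show ?thesis .
qed

lemma operation_op_comp:
  assumes "Field \<theta> = {..<length \<theta>s}" "\<And>\<eta>. \<eta> \<in> set \<theta>s \<Longrightarrow> operation \<eta>"
  shows "arity (op_comp \<theta> \<theta>s) = sum_list (map arity \<theta>s)"
    and "operation (op_comp \<theta> \<theta>s)"
proof -
  note eq = op_comp_eq_lex_sum[OF assms(1)]
  have F: "Field (lex_sum \<theta> ((!) \<theta>s)) =
      Sigma {..<length (map arity \<theta>s)} (\<lambda>i. {..<map arity \<theta>s ! i})"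
    using assms by (rule Field_lex_sum_nth)
  have Fc: "Field (op_comp \<theta> \<theta>s) = {..<sum_list (map arity \<theta>s)}"
    unfolding eq Field_map_prod F block_position_def by (rule image_block_position)
  then show "arity (op_comp \<theta> \<theta>s) = sum_list (map arity \<theta>s)"
    by (simp add: arity_def)
  have R: "(a, a) \<in> \<theta>s ! i" if "i < length \<theta>s" "a < arity (\<theta>s ! i)" for i a
    using that operationD[OF assms(2), of "\<theta>s ! i"] by (simp add: refl_on_def)
  have "(p, p) \<in> lex_sum \<theta> ((!) \<theta>s)" if "p \<in> Field (lex_sum \<theta> ((!) \<theta>s))" for p
    using that R FieldI(1)[OF R] unfolding F by (auto simp: lex_sum_def assms(1))
  then have "(m, m) \<in> op_comp \<theta> \<theta>s" if "m \<in> Field (op_comp \<theta> \<theta>s)" for m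
    using that unfolding eq Field_map_prod by auto
  then show "operation (op_comp \<theta> \<theta>s)"
    using Fc by (intro operationI) auto
qed

lemma op_relabel_eq: "op_relabel \<sigma> \<theta> = map_prod \<sigma> \<sigma> ` \<theta>"
  by (auto simp: op_relabel_def)

lemma operation_op_relabel:
  assumes "operation \<theta>" "\<sigma> permutes {..<arity \<theta>}"
  shows "arity (op_relabel \<sigma> \<theta>) = arity \<theta>" "operation (op_relabel \<sigma> \<theta>)"
proof -
  note \<theta> = operationD[OF assms(1)]
  have F: "Field (op_relabel \<sigma> \<theta>) = Field \<theta>"
    unfolding op_relabel_eq Field_map_prod \<theta>(1) using assms(2) by (rule permutes_image)
  then show "arity (op_relabel \<sigma> \<theta>) = arity \<theta>"
    by (simp add: arity_def)
  have "(i, i) \<in> op_relabel \<sigma> \<theta>" if "i \<in> \<sigma> ` Field \<theta>" for i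
    using that \<theta>(2) by (auto simp: op_relabel_eq refl_on_def)
  then show "operation (op_relabel \<sigma> \<theta>)"
    using F \<theta>(1) permutes_image[OF assms(2)] by (intro operationI[of _ "arity \<theta>"]) auto
qed

lemma SP_operad_operation: "\<theta> \<in> SP_operad \<Longrightarrow> operation \<theta>"
proof (induction rule: SP_operad.induct)
  case (op_comp \<theta> \<theta>s)
  then show ?case
    using operationD(1)[of \<theta>] by (intro operation_op_comp(2)) auto
next
  case (op_relabel \<theta> \<sigma>)
  then show ?case
    by (intro operation_op_relabel(2))
next
  case op_id
  show ?case by (rule operationI[of _ 1]) (auto simp: Field_op_id op_id_def)
next
  case op_disj
  show ?case by (rule operationI[of _ 2]) (auto simp: Field_op_disj op_disj_def)
next
  case op_ord
  show ?case by (rule operationI[of _ 2]) (auto simp: Field_op_ord op_ord_def)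
qed

lemma arity_op: "arity op_id = 1" "arity op_disj = 2" "arity op_ord = 2"
  by (simp_all add: arity_def Field_op_id Field_op_disj Field_op_ord)

lemma seq_op_id: "seq_op op_id [c] = c"
  by (simp add: fun_eq_iff seq_op_def op_id_def cover_sum_point)

text \<open>Passing to pairs and grouping covers into blocks gives nested cover sums; the entry of
  \<open>concat xss\<close> at the label of \<open>(i, a)\<close> is
  \<open>xss ! i ! a\<close>.\<close>

lemma seq_op_comp:
  assumes \<theta>: "operation \<theta>"
    and \<theta>s: "\<And>\<eta>. \<eta> \<in> set \<theta>s \<Longrightarrow> operation \<eta>"
    and len: "length \<theta>s = arity \<theta>" "map length xss = map arity \<theta>s"
  shows "seq_op (op_comp \<theta> \<theta>s) (concat xss) = seq_op \<theta> (map2 seq_op \<theta>s xss)"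
proof
  fix k
  let ?f = "block_position \<theta>s"
  have F\<theta>: "Field \<theta> = {..<length \<theta>s}"
    using operationD(1)[OF \<theta>] len by simp
  have R: "Refl (\<theta>s ! i)" and Fi: "Field (\<theta>s ! i) = {..<arity (\<theta>s ! i)}" if "i \<in> Field \<theta>" for i
    using operationD[OF \<theta>s, of "\<theta>s ! i"] that F\<theta> by simp_all
  note eq = op_comp_eq_lex_sum[OF F\<theta>]
  have F: "Field (lex_sum \<theta> ((!) \<theta>s)) =
      Sigma {..<length (map arity \<theta>s)} (\<lambda>i. {..<map arity \<theta>s ! i})"
    using F\<theta> \<theta>s by (rule Field_lex_sum_nth)
  have inj: "inj_on ?f (Field (lex_sum \<theta> ((!) \<theta>s)))"
    unfolding F block_position_def by (rule inj_on_block_position)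
  have lenxss: "length xss = length \<theta>s"
    using len by (metis length_map)
  have "seq_op (op_comp \<theta> \<theta>s) (concat xss) k =
      cover_sum (lex_sum \<theta> ((!) \<theta>s)) ((!) (concat xss) \<circ> ?f) {..<k}"
    unfolding seq_op_def eq by (rule cover_sum_map_prod[OF inj])
  also have "\<dots> = cover_sum \<theta> (\<lambda>i k. cover_sum (\<theta>s ! i) (\<lambda>a. ((!) (concat xss) \<circ> ?f) (i, a)) {..<k})
      {..<k}"
  proof (rule cover_sum_lex_sum)
    show "finite (Field \<theta>)"
      by (simp add: F\<theta>)
    show "finite (Field (\<theta>s ! i))" if "i \<in> Field \<theta>" for i
      by (simp add: Fi[OF that])
  qed (simp_all add: R)
  also have "\<dots> = cover_sum \<theta> (\<lambda>i. map2 seq_op \<theta>s xss ! i) {..<k}"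
  proof (rule cover_sum_cong, rule ext)
    fix i k assume i: "i \<in> Field \<theta>"
    then have i': "i < length \<theta>s" "i < length xss"
      using F\<theta> lenxss by auto
    have leni: "length (xss ! i) = arity (\<theta>s ! i)"
      using len(2) i' by (metis nth_map)
    have "cover_sum (\<theta>s ! i) (\<lambda>a. ((!) (concat xss) \<circ> ?f) (i, a)) {..<k} =
        cover_sum (\<theta>s ! i) (\<lambda>a. xss ! i ! a) {..<k}"
    proof (rule cover_sum_cong)
      fix a assume "a \<in> Field (\<theta>s ! i)"
      then have "a < length (xss ! i)"
        by (simp add: Fi[OF i] leni)
      from nth_concat_block_position[OF i'(2) this]
      show "((!) (concat xss) \<circ> ?f) (i, a) = xss ! i ! a"
        by (simp add: block_position_def len(2))
    qed
    then show "cover_sum (\<theta>s ! i) (\<lambda>a. ((!) (concat xss) \<circ> ?f) (i, a)) {..<k} =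
        (map2 seq_op \<theta>s xss ! i) k"
      using i' by (simp add: seq_op_def)
  qed
  finally show "seq_op (op_comp \<theta> \<theta>s) (concat xss) k = seq_op \<theta> (map2 seq_op \<theta>s xss) k"
    by (simp add: seq_op_def)
qed

text \<open>The point with new label \<open>\<sigma> i\<close> receives
  \<open>xs ! \<sigma> i\<close>, which is the entry at \<open>i\<close> of the permuted
  list.\<close>

lemma seq_op_relabel:
  assumes "Field \<theta> = {..<arity \<theta>}" "\<sigma> permutes {..<arity \<theta>}" "length xs = arity \<theta>"
  shows "seq_op (op_relabel \<sigma> \<theta>) xs = seq_op \<theta> (permute_list \<sigma> xs)"
proof
  fix k
  have "inj_on \<sigma> (Field \<theta>)"
    using permutes_inj_on[OF assms(2)] .
  then have "seq_op (op_relabel \<sigma> \<theta>) xs k = cover_sum \<theta> ((!) xs \<circ> \<sigma>) {..<k}"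
    unfolding seq_op_def op_relabel_eq by (rule cover_sum_map_prod)
  also have "\<dots> = seq_op \<theta> (permute_list \<sigma> xs) k"
    unfolding seq_op_def using assms by (intro cover_sum_cong) (auto simp: permute_list_nth fun_eq_iff)
  finally show "seq_op (op_relabel \<sigma> \<theta>) xs k = seq_op \<theta> (permute_list \<sigma> xs) k" .
qed

text \<open>Closure under the two generators propagates through substitution and relabelling, by
  induction on the generation of \<open>SP_operad\<close>.\<close>

lemma seq_op_closed:
  assumes B: "\<And>c d. c \<in> B \<Longrightarrow> d \<in> B \<Longrightarrow> seq_op op_disj [c, d] \<in> B"
      "\<And>c d. c \<in> B \<Longrightarrow> d \<in> B \<Longrightarrow> seq_op op_ord [c, d] \<in> B"
    and "\<theta> \<in> SP_operad" "length xs = arity \<theta>" "set xs \<subseteq> B"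
  shows "seq_op \<theta> xs \<in> B"
  using assms(3-)
proof (induction arbitrary: xs)
  case op_id
  then show ?case
    by (auto simp: arity_op length_Suc_conv seq_op_id)
next
  case op_disj
  then show ?case
    using B by (auto simp: arity_op length_Suc_conv numeral_2_eq_2)
next
  case op_ord
  then show ?case
    using B by (auto simp: arity_op length_Suc_conv numeral_2_eq_2)
next
  case (op_comp \<theta> \<theta>s)
  have \<theta>: "operation \<theta>" and \<theta>s: "\<And>\<eta>. \<eta> \<in> set \<theta>s \<Longrightarrow> operation \<eta>"
    using op_comp.hyps by (simp_all add: SP_operad_operation)
  have "length xs = sum_list (map arity \<theta>s)"
    using op_comp.prems(1) operation_op_comp(1)[of \<theta> \<theta>s] \<theta>s operationD(1)[OF \<theta>] op_comp.hyps by simp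
  then obtain xss where xss: "map length xss = map arity \<theta>s" "concat xss = xs"
    using concat_split_exists by blast
  have len: "length xss = length \<theta>s"
    using xss(1) by (metis length_map)
  have "seq_op (\<theta>s ! i) (xss ! i) \<in> B" if "i < length \<theta>s" for i
  proof -
    have "length (xss ! i) = arity (\<theta>s ! i)"
      using that len xss(1) by (metis nth_map)
    moreover have "set (xss ! i) \<subseteq> B"
      using that len op_comp.prems(2) xss(2) by fastforce
    ultimately show ?thesis
      using op_comp.IH(2)[of "\<theta>s ! i"] that by simp
  qed
  then have "set (map2 seq_op \<theta>s xss) \<subseteq> B"
    using len by (auto simp: set_zip)
  moreover have "seq_op (op_comp \<theta> \<theta>s) xs = seq_op \<theta> (map2 seq_op \<theta>s xss)"
    using seq_op_comp[OF \<theta> \<theta>s op_comp.hyps(2) xss(1)] xss(2) by simp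
  ultimately show ?case
    using op_comp.IH(1)[of "map2 seq_op \<theta>s xss"] op_comp.hyps(2) len by simp
next
  case (op_relabel \<theta> \<sigma>)
  note \<theta> = SP_operad_operation[OF op_relabel.hyps(1)]
  have len: "length xs = arity \<theta>"
    using op_relabel.prems(1) operation_op_relabel(1)[OF \<theta> op_relabel.hyps(2)] by simp
  then have "set (permute_list \<sigma> xs) \<subseteq> B"
    using op_relabel by (simp add: set_permute_list)
  then show ?case
    using op_relabel.IH[of "permute_list \<sigma> xs"] len
    by (simp add: seq_op_relabel[OF operationD(1)[OF \<theta>] op_relabel.hyps(2) len])
qed

text \<open>The identity, composition and equivariance laws hold for all sequences; only closure
  depends on the carrier \<open>B\<close>.\<close>

lemma SP_algebra_seq_op:
  fixes B :: "(nat \<Rightarrow> 'b::comm_semiring_1) set"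
  assumes B: "\<And>c d. c \<in> B \<Longrightarrow> d \<in> B \<Longrightarrow> seq_op op_disj [c, d] \<in> B"
      "\<And>c d. c \<in> B \<Longrightarrow> d \<in> B \<Longrightarrow> seq_op op_ord [c, d] \<in> B"
  shows "SP_algebra B seq_op"
  unfolding SP_algebra_def
proof (intro conjI ballI allI impI)
  fix \<theta> xs assume "\<theta> \<in> SP_operad" "length xs = arity \<theta>" "set xs \<subseteq> B"
  then show "seq_op \<theta> xs \<in> B"
    using seq_op_closed[OF B] by blast
next
  fix \<theta> \<theta>s and xss :: "(nat \<Rightarrow> 'b) list list"
  assume "\<theta> \<in> SP_operad" "length \<theta>s = arity \<theta>" "set \<theta>s \<subseteq> SP_operad"
    "map length xss = map arity \<theta>s"
  then show "seq_op (op_comp \<theta> \<theta>s) (concat xss) = seq_op \<theta> (map2 seq_op \<theta>s xss)"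
    by (intro seq_op_comp) (auto intro: SP_operad_operation)
next
  fix \<theta> \<sigma> and xs :: "(nat \<Rightarrow> 'b) list"
  assume "\<theta> \<in> SP_operad" "\<sigma> permutes {..<arity \<theta>}" "length xs = arity \<theta>"
  then show "seq_op (op_relabel \<sigma> \<theta>) xs = seq_op \<theta> (permute_list \<sigma> xs)"
    by (intro seq_op_relabel operationD(1) SP_operad_operation)
qed (simp add: seq_op_id)

text \<open>Transport of structure: arguments are pulled back to \<open>B\<close>, the operation is
  applied there, and the value is pushed forward.\<close>

lemma SP_algebra_transfer:
  assumes alg: "SP_algebra B \<alpha>" and inj: "inj_on h B"
  shows "SP_algebra (h ` B) (\<lambda>\<theta> xs. h (\<alpha> \<theta> (map (inv_into B h) xs)))"
proof -
  define g where "g = inv_into B h"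
  have gh: "g (h x) = x" if "x \<in> B" for x
    using that inj by (simp add: g_def)
  have gB: "set (map g xs) \<subseteq> B" if "set xs \<subseteq> h ` B" for xs
    using that gh by auto
  have closed: "\<alpha> \<theta> xs \<in> B" if "\<theta> \<in> SP_operad" "length xs = arity \<theta>" "set xs \<subseteq> B" for \<theta> xs
    using alg that unfolding SP_algebra_def by blast
  have comp: "\<alpha> (op_comp \<theta> \<theta>s) (concat xss) = \<alpha> \<theta> (map2 \<alpha> \<theta>s xss)"
    if "\<theta> \<in> SP_operad" "length \<theta>s = arity \<theta>" "set \<theta>s \<subseteq> SP_operad"
      "map length xss = map arity \<theta>s" "\<forall>xs \<in> set xss. set xs \<subseteq> B" for \<theta> \<theta>s xss
    using alg that unfolding SP_algebra_def by blast
  have relabel: "\<alpha> (op_relabel \<sigma> \<theta>) xs = \<alpha> \<theta> (permute_list \<sigma> xs)"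
    if "\<theta> \<in> SP_operad" "\<sigma> permutes {..<arity \<theta>}" "length xs = arity \<theta>" "set xs \<subseteq> B" for \<theta> \<sigma> xs
    using alg that unfolding SP_algebra_def by blast
  have id: "\<alpha> op_id [x] = x" if "x \<in> B" for x
    using alg that unfolding SP_algebra_def by blast
  show ?thesis
    unfolding SP_algebra_def g_def[symmetric]
  proof (intro conjI ballI allI impI)
    fix \<theta> xs assume "\<theta> \<in> SP_operad" "length xs = arity \<theta>" "set xs \<subseteq> h ` B"
    then show "h (\<alpha> \<theta> (map g xs)) \<in> h ` B"
      using gB by (intro imageI closed) auto
  next
    fix x assume "x \<in> h ` B"
    then show "h (\<alpha> op_id (map g [x])) = x"
      using gh by (auto simp: id)
  next
    fix \<theta> \<theta>s xss
    assume *: "\<theta> \<in> SP_operad" "length \<theta>s = arity \<theta>" "set \<theta>s \<subseteq> SP_operad"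
      "map length xss = map arity \<theta>s" "\<forall>xs \<in> set xss. set xs \<subseteq> h ` B"
    define yss where "yss = map (map g) xss"
    have yss: "map length yss = map arity \<theta>s" "\<forall>ys \<in> set yss. set ys \<subseteq> B"
      using * gB by (auto simp: yss_def comp_def)
    have len: "length yss = length \<theta>s"
      using yss(1) by (metis length_map)
    \<comment> \<open>Pulling back cancels the pushforward of the inner values, since these lie in
      \<open>B\<close> by closure.\<close>
    have "map g (map2 (\<lambda>\<theta> xs. h (\<alpha> \<theta> (map g xs))) \<theta>s xss) = map2 \<alpha> \<theta>s yss"
    proof (rule nth_equalityI)
      fix i assume "i < length (map g (map2 (\<lambda>\<theta> xs. h (\<alpha> \<theta> (map g xs))) \<theta>s xss))"
      then have i: "i < length \<theta>s" "i < length xss" "i < length yss"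
        by (auto simp: yss_def)
      have "length (yss ! i) = arity (\<theta>s ! i)"
        using i yss(1) by (metis nth_map)
      then have "\<alpha> (\<theta>s ! i) (yss ! i) \<in> B"
        using i * yss by (intro closed) auto
      then show "map g (map2 (\<lambda>\<theta> xs. h (\<alpha> \<theta> (map g xs))) \<theta>s xss) ! i = map2 \<alpha> \<theta>s yss ! i"
        using i gh by (simp add: yss_def)
    qed (simp add: yss_def)
    then show "h (\<alpha> (op_comp \<theta> \<theta>s) (map g (concat xss))) =
        h (\<alpha> \<theta> (map g (map2 (\<lambda>\<theta> xs. h (\<alpha> \<theta> (map g xs))) \<theta>s xss)))"
      using comp[OF *(1-3) yss] by (simp add: map_concat yss_def)
  next
    fix \<theta> \<sigma> xs
    assume *: "\<theta> \<in> SP_operad" "\<sigma> permutes {..<arity \<theta>}" "length xs = arity \<theta>" "set xs \<subseteq> h ` B"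
    then have "permute_list \<sigma> (map g xs) = map g (permute_list \<sigma> xs)"
      by (simp add: permute_list_map)
    then show "h (\<alpha> (op_relabel \<sigma> \<theta>) (map g xs)) = h (\<alpha> \<theta> (map g (permute_list \<sigma> xs)))"
      using relabel[OF *(1,2)] *(3,4) gB by simp
  qed
qed

section \<open>Polynomials of series-parallel posets\<close>

text \<open>The power of \<open>s\<close> is multiplicative over disjoint posets; for
  \<open>s = -1\<close> it contributes the sign \<open>(-1)^|P|\<close>, and the remaining
  \<open>(-1)^i\<close> comes from substituting a negated series. Surjection counts, unlike
  \<open>d_coeff\<close>, also give the empty poset its polynomial, the constant 1.\<close>

definition shuffle_poly :: "rat \<Rightarrow> 'a rel \<Rightarrow> rat poly" where
  "shuffle_poly s P = smult (s ^ card (Field P)) (Abs_poly (\<lambda>k. of_nat (surj_count P k)))"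

text \<open>Surjection counts vanish above the size of the poset, so the sequence in
  \<open>Abs_poly\<close> is eventually zero.\<close>

lemma coeff_shuffle_poly:
  assumes "finite (Field P)"
  shows "coeff (shuffle_poly s P) k = s ^ card (Field P) * of_nat (surj_count P k)"
  unfolding shuffle_poly_def
  by (simp, subst coeff_Abs_poly[where n = "card (Field P)"]) (use surj_count_eq_0[OF assms] in auto)

lemma degree_shuffle_poly:
  assumes "finite (Field P)"
  shows "degree (shuffle_poly s P) \<le> card (Field P)"
  using assms by (intro degree_le) (simp add: coeff_shuffle_poly surj_count_eq_0)

lemma shuffle_poly_empty: "shuffle_poly s {} = 1"
  by (rule poly_eqI) (simp add: coeff_shuffle_poly surj_count_empty)

lemma shuffle_poly_point: "shuffle_poly s {(a, a)} = [:0, s:]"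
  by (rule poly_eqI)
     (auto simp: coeff_shuffle_poly surj_count_point coeff_pCons Field_def split: nat.splits)

lemma cover_sum_mult:
  assumes "finite (Field \<theta>)"
  shows "cover_sum \<theta> (\<lambda>i k. s i * c i k) T = (\<Prod>i\<in>Field \<theta>. s i) * cover_sum \<theta> c T"
  by (simp add: cover_sum_def prod.distrib sum_distrib_left)

lemma Field_disj_union: "Field (P \<squnion>\<^sub>P Q) = Field P \<union> Field Q"
  and Field_ord_sum: "Field (P \<oplus>\<^sub>P Q) = Field P \<union> Field Q"
  by (auto simp: disj_union_def ord_sum_def Field_def)

text \<open>Sizes add, so the power of \<open>s\<close> is a product of scalars attached to the two
  points of the operation, and such scalars can be moved into the cover sum.\<close>

lemma shuffle_poly_binary:
  assumes fin: "finite (Field P)" "finite (Field Q)" and reflx: "Refl P" "Refl Q"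
    and disj: "Field P \<inter> Field Q = {}"
  shows "coeff (shuffle_poly s (P \<squnion>\<^sub>P Q)) =
      seq_op op_disj [coeff (shuffle_poly s P), coeff (shuffle_poly s Q)]"
    and "coeff (shuffle_poly s (P \<oplus>\<^sub>P Q)) =
      seq_op op_ord [coeff (shuffle_poly s P), coeff (shuffle_poly s Q)]"
proof -
  define \<eta> where "\<eta> i = (if i = 0 then P else Q)" for i :: nat
  have *: "coeff (shuffle_poly s R) =
      seq_op \<theta> [coeff (shuffle_poly s P), coeff (shuffle_poly s Q)]"
    if R: "Field R = Field P \<union> Field Q" "\<And>k. surj_count R k = cover_sum \<theta> (\<lambda>i. surj_count (\<eta> i)) {..<k}"
      and \<theta>: "Field \<theta> = {0, 1}" for R and \<theta> :: "nat rel"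
  proof
    fix k
    have "finite (Field R)" "card (Field R) = card (Field P) + card (Field Q)"
      using fin disj by (simp_all add: R(1) card_Un_disjoint)
    then have "coeff (shuffle_poly s R) k = (\<Prod>i\<in>Field \<theta>. s ^ card (Field (\<eta> i))) *
        cover_sum \<theta> (\<lambda>i k. of_nat (surj_count (\<eta> i) k)) {..<k}"
      by (simp add: coeff_shuffle_poly R(2) of_nat_cover_sum \<theta> \<eta>_def power_add)
    also have "\<dots> = cover_sum \<theta> (\<lambda>i k. s ^ card (Field (\<eta> i)) * of_nat (surj_count (\<eta> i) k)) {..<k}"
      by (rule cover_sum_mult[symmetric]) (simp add: \<theta>)
    also have "\<dots> = seq_op \<theta> [coeff (shuffle_poly s P), coeff (shuffle_poly s Q)] k"
      unfolding seq_op_def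
      by (rule cover_sum_cong) (auto simp: \<theta> \<eta>_def coeff_shuffle_poly fin fun_eq_iff)
    finally show "coeff (shuffle_poly s R) k =
      seq_op \<theta> [coeff (shuffle_poly s P), coeff (shuffle_poly s Q)] k" .
  qed
  show "coeff (shuffle_poly s (P \<squnion>\<^sub>P Q)) =
      seq_op op_disj [coeff (shuffle_poly s P), coeff (shuffle_poly s Q)]"
    "coeff (shuffle_poly s (P \<oplus>\<^sub>P Q)) =
      seq_op op_ord [coeff (shuffle_poly s P), coeff (shuffle_poly s Q)]"
    by (intro *; simp add: \<eta>_def Field_disj_union Field_ord_sum surj_count_binary[OF assms] Field_op_disj Field_op_ord)+
qed

text \<open>Convolution over the cuts of a chain is the Cauchy product.\<close>

lemma seq_op_op_ord_coeff: "seq_op op_ord [coeff p, coeff q] = coeff (p * q)"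
  by (simp add: fun_eq_iff seq_op_def cover_sum_op_ord coeff_mult)

section \<open>The empty poset and disjoint copies\<close>

definition SP_or_empty :: "'a rel \<Rightarrow> bool" where
  "SP_or_empty P \<longleftrightarrow> P = {} \<or> SP_poset P"

lemma SP_or_empty_finite_Refl:
  assumes "SP_or_empty P"
  shows "finite (Field P)" "Refl P"
proof -
  have "finite (Field P) \<and> Refl P"
  proof (cases "P = {}")
    case False
    then have "finite P \<and> Partial_order P"
      using assms SP_poset_finite_partial_order by (auto simp: SP_or_empty_def)
    then show ?thesis
      unfolding partial_order_on_def preorder_on_def by (blast intro: finite_Field)
  qed (simp add: refl_on_def)
  then show "finite (Field P)" "Refl P"
    by blast+
qed

lemma SP_or_empty_binary:
  assumes "SP_or_empty P" "SP_or_empty Q" "Field P \<inter> Field Q = {}"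
  shows "SP_or_empty (P \<squnion>\<^sub>P Q)" "SP_or_empty (P \<oplus>\<^sub>P Q)"
proof -
  have "P \<squnion>\<^sub>P {} = P" "P \<oplus>\<^sub>P {} = P" "{} \<squnion>\<^sub>P Q = Q" "{} \<oplus>\<^sub>P Q = Q"
    by (simp_all add: disj_union_def ord_sum_def)
  then show "SP_or_empty (P \<squnion>\<^sub>P Q)" "SP_or_empty (P \<oplus>\<^sub>P Q)"
    using assms SP_poset.disj_union[of P Q] SP_poset.ord_sum[of P Q]
    unfolding SP_or_empty_def by auto
qed

lemma shuffle_poly_SP_binary:
  assumes "SP_or_empty P" "SP_or_empty Q" "Field P \<inter> Field Q = {}"
  shows "coeff (shuffle_poly s (P \<squnion>\<^sub>P Q)) =
      seq_op op_disj [coeff (shuffle_poly s P), coeff (shuffle_poly s Q)]"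
    and "coeff (shuffle_poly s (P \<oplus>\<^sub>P Q)) =
      seq_op op_ord [coeff (shuffle_poly s P), coeff (shuffle_poly s Q)]"
  by (rule shuffle_poly_binary; use assms SP_or_empty_finite_Refl in blast)+

text \<open>The construction of \<open>P\<close> is repeated with fresh points, available in an
  infinite type; the polynomial is determined by the construction.\<close>

lemma SP_poset_disjoint_copy:
  fixes P :: "'a::infinite rel" and X :: "'a set"
  assumes "SP_poset P" "finite X"
  shows "\<exists>P'. SP_poset P' \<and> Field P' \<inter> X = {} \<and> shuffle_poly s P' = shuffle_poly s P"
  using assms
proof (induction arbitrary: X)
  case (point a)
  obtain b where "b \<notin> X"
    using arb_element[OF point.prems] by blast
  then show ?case
    by (intro exI[of _ "{(b, b)}"]) (auto simp: shuffle_poly_point SP_poset.point Field_def)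
next
  case (disj_union P Q)
  obtain P' where P': "SP_poset P'" "Field P' \<inter> X = {}" "shuffle_poly s P' = shuffle_poly s P"
    using disj_union.IH(1)[OF disj_union.prems] by blast
  then have "finite (Field P' \<union> X)"
    using SP_or_empty_finite_Refl(1)[of P'] disj_union.prems by (simp add: SP_or_empty_def)
  \<comment> \<open>The second copy has to avoid the first as well as \<open>X\<close>; hence the
    induction varies \<open>X\<close>.\<close>
  then obtain Q' where Q': "SP_poset Q'" "Field Q' \<inter> (Field P' \<union> X) = {}"
      "shuffle_poly s Q' = shuffle_poly s Q"
    using disj_union.IH(2)[of "Field P' \<union> X"] by blast
  then have disj: "Field P' \<inter> Field Q' = {}"
    by blast
  have "coeff (shuffle_poly s (P' \<squnion>\<^sub>P Q')) = coeff (shuffle_poly s (P \<squnion>\<^sub>P Q))"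
    using P' Q' disj_union.hyps shuffle_poly_SP_binary(1)[of P Q s] shuffle_poly_SP_binary(1)[of P' Q' s]
      disj by (simp add: SP_or_empty_def)
  then have "shuffle_poly s (P' \<squnion>\<^sub>P Q') = shuffle_poly s (P \<squnion>\<^sub>P Q)"
    by (simp only: coeff_inject)
  moreover have "SP_poset (P' \<squnion>\<^sub>P Q')"
    using P' Q' by (intro SP_poset.disj_union) auto
  moreover have "Field (P' \<squnion>\<^sub>P Q') \<inter> X = {}"
    using P' Q' by (auto simp: Field_disj_union)
  ultimately show ?case
    by blast
next
  case (ord_sum P Q)
  obtain P' where P': "SP_poset P'" "Field P' \<inter> X = {}" "shuffle_poly s P' = shuffle_poly s P"
    using ord_sum.IH(1)[OF ord_sum.prems] by blast
  then have "finite (Field P' \<union> X)"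
    using SP_or_empty_finite_Refl(1)[of P'] ord_sum.prems by (simp add: SP_or_empty_def)
  then obtain Q' where Q': "SP_poset Q'" "Field Q' \<inter> (Field P' \<union> X) = {}"
      "shuffle_poly s Q' = shuffle_poly s Q"
    using ord_sum.IH(2)[of "Field P' \<union> X"] by blast
  then have disj: "Field P' \<inter> Field Q' = {}"
    by blast
  have "coeff (shuffle_poly s (P' \<oplus>\<^sub>P Q')) = coeff (shuffle_poly s (P \<oplus>\<^sub>P Q))"
    using P' Q' ord_sum.hyps shuffle_poly_SP_binary(2)[of P Q s] shuffle_poly_SP_binary(2)[of P' Q' s]
      disj by (simp add: SP_or_empty_def)
  then have "shuffle_poly s (P' \<oplus>\<^sub>P Q') = shuffle_poly s (P \<oplus>\<^sub>P Q)"
    by (simp only: coeff_inject)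
  moreover have "SP_poset (P' \<oplus>\<^sub>P Q')"
    using P' Q' by (intro SP_poset.ord_sum) auto
  moreover have "Field (P' \<oplus>\<^sub>P Q') \<inter> X = {}"
    using P' Q' by (auto simp: Field_ord_sum)
  ultimately show ?case
    by blast
qed

text \<open>Elements of the carrier may come from overlapping posets; with disjoint representatives
  the operations on posets apply.\<close>

lemma SP_or_empty_disjoint_copy:
  fixes P Q :: "'a::infinite rel"
  assumes "SP_or_empty P" "SP_or_empty Q"
  obtains Q' where "SP_or_empty Q'" "Field P \<inter> Field Q' = {}"
    "shuffle_poly s Q' = shuffle_poly s Q"
proof (cases "Q = {}")
  case True
  then show ?thesis
    using that[of "{}"] by (simp add: SP_or_empty_def)
next
  case False
  then have "SP_poset Q"
    using assms(2) by (simp add: SP_or_empty_def)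
  then show ?thesis
    using SP_poset_disjoint_copy[OF _ SP_or_empty_finite_Refl(1)[OF assms(1)]] that
    unfolding SP_or_empty_def by (metis inf_commute)
qed

text \<open>The polynomials of the posets form an algebra of coefficient sequences, since disjoint
  copies realise both operations inside the family; the injective \<open>h\<close> carries it to the
  series.\<close>

lemma SP_series_algebraI:
  fixes F :: "'a::infinite rel \<Rightarrow> 'x"
  assumes inj: "inj h"
    and F: "\<And>P. SP_or_empty P \<Longrightarrow> F P = h (shuffle_poly s P)"
    and dis: "\<And>p q r. coeff r = seq_op op_disj [coeff p, coeff q] \<Longrightarrow> dis (h p) (h q) = h r"
    and ord: "\<And>p q. ord (h p) (h q) = h (p * q)"
  shows "SP_series_algebra F (h [:0, s:]) (h 1) dis ord"
proof -
  define S where "S = shuffle_poly s ` {P :: 'a rel. SP_or_empty P}"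
  define A where "A = insert (F {}) {F P | P. SP_poset P}"
  \<comment> \<open>The algebra lives on sequences, \<open>h\<close> on polynomials;
    \<open>H\<close> agrees with \<open>h\<close> on coefficient sequences.\<close>
  define H where "H = (\<lambda>c. h (Abs_poly c))"
  have H: "H (coeff p) = h p" for p
    by (simp add: H_def coeff_inverse)
  have FE: "F {} = h 1"
    using F[of "{}"] by (simp add: SP_or_empty_def shuffle_poly_empty)
  have binary: "\<exists>r\<in>S. coeff r = seq_op op_disj [coeff p, coeff q]"
      "\<exists>r\<in>S. coeff r = seq_op op_ord [coeff p, coeff q]" if "p \<in> S" "q \<in> S" for p q
  proof -
    obtain P Q :: "'a rel" where P: "SP_or_empty P" "p = shuffle_poly s P"
      and Q: "SP_or_empty Q" "q = shuffle_poly s Q"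
      using \<open>p \<in> S\<close> \<open>q \<in> S\<close> unfolding S_def by blast
    obtain Q' where Q': "SP_or_empty Q'" "Field P \<inter> Field Q' = {}" "q = shuffle_poly s Q'"
      using SP_or_empty_disjoint_copy[OF P(1) Q(1), of s] Q(2) by metis
    show "\<exists>r\<in>S. coeff r = seq_op op_disj [coeff p, coeff q]"
      "\<exists>r\<in>S. coeff r = seq_op op_ord [coeff p, coeff q]"
      using shuffle_poly_SP_binary[OF P(1) Q'(1,2)] SP_or_empty_binary[OF P(1) Q'(1,2)] P(2) Q'(3)
      unfolding S_def by blast+
  qed
  have A: "A = h ` S"
  proof -
    have "A = F ` {P. SP_or_empty P}"
      unfolding A_def SP_or_empty_def by auto
    also have "\<dots> = h ` S"
      unfolding S_def image_image using F by (intro image_cong) auto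
    finally show ?thesis .
  qed
  have AH: "A = H ` coeff ` S"
    by (simp add: A image_image H)
  have injH: "inj_on H (coeff ` S)"
    using inj by (auto simp: inj_on_def H dest: injD)
  have "SP_algebra (coeff ` S) seq_op"
    using binary by (intro SP_algebra_seq_op) (force simp: image_iff)+
  then have "SP_algebra A (\<lambda>\<theta> xs. H (seq_op \<theta> (map (inv_into (coeff ` S) H) xs)))" (is "SP_algebra A ?\<alpha>")
    unfolding AH using injH by (rule SP_algebra_transfer)
  moreover have "?\<alpha> op_disj [f, g] = dis f g \<and> ?\<alpha> op_ord [f, g] = ord f g"
    if "f \<in> A" "g \<in> A" for f g
  proof -
    obtain p q where p: "p \<in> S" "f = h p" and q: "q \<in> S" "g = h q"
      using \<open>f \<in> A\<close> \<open>g \<in> A\<close> unfolding A by blast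
    have inv: "inv_into (coeff ` S) H (h p) = coeff p" if "p \<in> S" for p
      using inv_into_f_f[OF injH, of "coeff p"] that by (simp add: H)
    obtain r where r: "coeff r = seq_op op_disj [coeff p, coeff q]"
      using binary(1)[OF p(1) q(1)] by blast
    then have "H (seq_op op_disj [coeff p, coeff q]) = dis f g"
      using dis[OF r] p q by (metis H)
    moreover have "H (seq_op op_ord [coeff p, coeff q]) = ord f g"
      by (simp add: seq_op_op_ord_coeff H ord p q)
    ultimately show ?thesis
      using p q inv by simp
  qed
  moreover have "F (P \<squnion>\<^sub>P Q) = dis (F P) (F Q) \<and> F (P \<oplus>\<^sub>P Q) = ord (F P) (F Q)"
    if "SP_poset P" "SP_poset Q" and PQ: "Field P \<inter> Field Q = {}" for P Q
  proof -
    have SP: "SP_or_empty P" "SP_or_empty Q"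
      using that by (simp_all add: SP_or_empty_def)
    have "shuffle_poly s (P \<oplus>\<^sub>P Q) = shuffle_poly s P * shuffle_poly s Q"
      using shuffle_poly_SP_binary(2)[OF SP PQ] by (simp add: seq_op_op_ord_coeff coeff_inject)
    then show ?thesis
      using dis[OF shuffle_poly_SP_binary(1)[OF SP PQ]] SP SP_or_empty_binary[OF SP PQ] by (simp add: F ord)
  qed
  moreover have "F {(a, a)} = h [:0, s:]" for a
    using F[of "{(a, a)}"] by (simp add: SP_or_empty_def SP_poset.point shuffle_poly_point)
  moreover have "dis (h 1) f = f \<and> dis f (h 1) = f \<and> ord (h 1) f = f \<and> ord f (h 1) = f"
    if "f \<in> A" for f
  proof -
    obtain P :: "'a rel" where P: "SP_or_empty P" "f = h (shuffle_poly s P)"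
      using \<open>f \<in> A\<close> unfolding A S_def by blast
    have "SP_or_empty ({} :: 'a rel)"
      by (simp add: SP_or_empty_def)
    \<comment> \<open>The union of \<open>P\<close> with the empty poset is \<open>P\<close>; on
      coefficients this is the unit law of \<open>op_disj\<close>.\<close>
    then have "coeff (shuffle_poly s P) = seq_op op_disj [coeff 1, coeff (shuffle_poly s P)]"
      "coeff (shuffle_poly s P) = seq_op op_disj [coeff (shuffle_poly s P), coeff 1]"
      using shuffle_poly_SP_binary(1)[of "{}" P] shuffle_poly_SP_binary(1)[of P "{}"] P(1)
      by (simp_all add: shuffle_poly_empty disj_union_def)
    then show ?thesis
      using dis ord[of 1] ord[of _ 1] P(2) by auto
  qed
  ultimately show ?thesis
    unfolding SP_series_algebra_def Let_def A_def[symmetric]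
    unfolding FE by blast
qed

section \<open>Substitution of power series\<close>

text \<open>Polynomial evaluation, meaningful for any constant term of \<open>w\<close>; both
  \<open>1/(1-x)\<close> and \<open>1-x\<close> have constant term 1.\<close>

definition subst_poly :: "rat fps \<Rightarrow> rat poly \<Rightarrow> rat fps" where
  "subst_poly w p = poly (map_poly fps_const p) w"

lemma subst_poly_0 [simp]: "subst_poly w 0 = 0"
  and subst_poly_pCons [simp]: "subst_poly w (pCons a p) = fps_const a + w * subst_poly w p"
  by (simp_all add: subst_poly_def map_poly_pCons)

lemma subst_poly_add: "subst_poly w (p + q) = subst_poly w p + subst_poly w q"
  by (induction p q rule: poly_induct2) (simp_all add: algebra_simps flip: fps_const_add)

lemma subst_poly_smult: "subst_poly w (smult a p) = fps_const a * subst_poly w p"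
  by (induction p) (simp_all add: algebra_simps)

lemma subst_poly_mult: "subst_poly w (p * q) = subst_poly w p * subst_poly w q"
  by (induction p) (simp_all add: subst_poly_add subst_poly_smult algebra_simps)

lemma subst_poly_pcompose: "subst_poly w (pcompose p q) = subst_poly (subst_poly w q) p"
  by (induction p) (simp_all add: pcompose_pCons subst_poly_add subst_poly_mult)

text \<open>Trades a sign in the polynomial for one in the substituted series: \<open>psi\<close> is
  described by unsigned series, the posets by signed ones.\<close>

lemma subst_poly_uminus: "subst_poly w (pcompose p [:0, -1:]) = subst_poly (- w) p"
  by (simp add: subst_poly_pcompose flip: fps_const_neg)

lemma subst_poly_eq_sum:
  assumes "degree p \<le> n"
  shows "subst_poly w p = (\<Sum>k\<le>n. fps_const (coeff p k) * w ^ k)"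
proof -
  have "subst_poly w p = (\<Sum>k\<le>degree p. fps_const (coeff p k) * w ^ k)"
    by (simp add: subst_poly_def poly_altdef coeff_map_poly degree_map_poly)
  also have "\<dots> = (\<Sum>k\<le>n. fps_const (coeff p k) * w ^ k)"
    using assms by (intro sum.mono_neutral_left) (auto simp: coeff_eq_0)
  finally show ?thesis .
qed

text \<open>Comparing constant terms kills the lowest coefficient; the remaining factor
  \<open>w\<close> cancels in an integral domain.\<close>

lemma subst_poly_eq_0:
  assumes "w \<noteq> 0" "fps_nth w 0 = 0" "subst_poly w p = 0"
  shows "p = 0"
  using assms(3)
proof (induction p)
  case (pCons a p)
  have "fps_nth (fps_const a + w * subst_poly w p) 0 = 0"
    using pCons.prems by simp
  then have "a = 0"
    using assms(2) by simp
  then show ?case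
    using pCons assms(1) by simp
qed simp

text \<open>A power series that is not constant is transcendental over the constants: a translation
  reduces this to vanishing constant term.\<close>

lemma inj_subst_poly:
  assumes "w \<noteq> fps_const (fps_nth w 0)"
  shows "inj (subst_poly w)"
proof (rule injI)
  fix p q assume eq: "subst_poly w p = subst_poly w q"
  define c where "c = fps_nth w 0"
  \<comment> \<open>Precomposing with \<open>x + c\<close> compensates for the removal of the
    constant term.\<close>
  have "subst_poly (w - fps_const c) [:c, 1:] = w"
    by simp
  then have "subst_poly (w - fps_const c) (pcompose (p - q) [:c, 1:]) = subst_poly w (p - q)"
    by (simp only: subst_poly_pcompose)
  also have "\<dots> = 0"
    using eq subst_poly_add[of w "p - q" q] by simp
  finally have "pcompose (p - q) [:c, 1:] = 0"
    by (rule subst_poly_eq_0[rotated 2]) (use assms in \<open>simp_all add: c_def\<close>)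
  then have "p - q = 0"
    by (rule pcompose_eq_0) simp
  then show "p = q"
    by simp
qed

section \<open>The order polynomial: evaluation in the binomial basis\<close>

definition binomial_eval :: "rat poly \<Rightarrow> rat \<Rightarrow> rat" where
  "binomial_eval p x = (\<Sum>k\<le>degree p. coeff p k * (x gchoose k))"

lemma binomial_eval_of_nat:
  "binomial_eval p (of_nat n) = (\<Sum>T\<in>Pow {..<n}. coeff p (card T))"
proof -
  have "(\<Sum>T\<in>Pow {..<n}. coeff p (card T)) = (\<Sum>k\<le>n. coeff p k * of_nat (n choose k))"
    using sum_Pow_card[of "{..<n}" "coeff p"] by (simp add: mult.commute)
  also have "\<dots> = (\<Sum>k\<in>{..n} \<union> {..degree p}. coeff p k * of_nat (n choose k))"
    by (intro sum.mono_neutral_left) auto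
  also have "\<dots> = (\<Sum>k\<le>degree p. coeff p k * of_nat (n choose k))"
    by (intro sum.mono_neutral_right) (auto simp: coeff_eq_0)
  finally show ?thesis
    by (simp add: binomial_eval_def binomial_gbinomial)
qed

text \<open>Through polynomiality in \<open>x\<close>, identities at natural numbers extend to all
  arguments.\<close>

lemma binomial_eval_poly: "\<exists>q. \<forall>x. poly q x = binomial_eval p x"
proof -
  define q where "q = (\<Sum>k\<le>degree p. smult (coeff p k / fact k) (\<Prod>i=0..<k. [:- of_nat i, 1:]))"
  have "poly q x = binomial_eval p x" for x
    by (simp add: q_def binomial_eval_def poly_sum poly_prod gbinomial_prod_rev)
  then show ?thesis
    by blast
qed

text \<open>At a natural number both sides sum over pairs of subsets of a chain; polynomials that
  agree at infinitely many points coincide. This reaches the negative arguments that occur in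
  \<open>SH\<close>.\<close>

lemma binomial_eval_mult:
  assumes r: "coeff r = seq_op op_disj [coeff p, coeff q]"
  shows "binomial_eval r x = binomial_eval p x * binomial_eval q x"
proof -
  have nat: "binomial_eval r (of_nat n) = binomial_eval p (of_nat n) * binomial_eval q (of_nat n)" for n
  proof -
    have "binomial_eval r (of_nat n) =
        (\<Sum>T\<in>Pow {..<n}. cover_sum op_disj ((!) [coeff p, coeff q]) {..<card T})"
      by (simp add: binomial_eval_of_nat r seq_op_def)
    \<comment> \<open>With \<open>T\<close> itself as the chain, the covers together run through all
      pairs of subsets of \<open>{..<n}\<close>.\<close>
    also have "\<dots> = (\<Sum>T\<in>Pow {..<n}. cover_sum op_disj ((!) [coeff p, coeff q]) T)"
      by (intro sum.cong refl cover_sum_card[symmetric]) (auto intro: finite_subset)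
    also have "\<dots> = (\<Prod>i\<in>{0, 1}. \<Sum>S\<in>Pow {..<n}. ([coeff p, coeff q] ! i) (card S))"
      unfolding Field_op_disj[symmetric]
      by (rule sum_cover_sum_antichain) (auto simp: Field_op_disj, auto simp: op_disj_def)
    finally show ?thesis
      by (simp add: binomial_eval_of_nat)
  qed
  obtain r' p' q' where *: "\<And>x. poly r' x = binomial_eval r x" "\<And>x. poly p' x = binomial_eval p x"
      "\<And>x. poly q' x = binomial_eval q x"
    using binomial_eval_poly by metis
  have "range of_nat \<subseteq> {x. poly (r' - p' * q') x = 0}"
    using nat by (auto simp: *)
  moreover have "infinite (range (of_nat :: nat \<Rightarrow> rat))"
    by (intro range_inj_infinite inj_of_nat)
  ultimately have "r' - p' * q' = 0"
    using poly_roots_finite finite_subset by blast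
  then show ?thesis
    by (metis * eq_iff_diff_eq_0 poly_mult)
qed

section \<open>Coefficients in powers of the geometric series\<close>

definition geo :: "rat fps" where
  "geo = 1 / (1 - fps_X)"

lemma geo_inverse: "geo = inverse (1 - fps_X)"
  by (simp add: geo_def fps_divide_unit)

lemma geo_mult: "geo * (1 - fps_X) = 1" "(1 - fps_X) * geo = 1"
  by (simp_all add: geo_inverse inverse_mult_eq_1 inverse_mult_eq_1')

lemma divide_one_minus_X_power: "f / (1 - fps_X) ^ k = f * geo ^ k"
  by (simp add: fps_divide_unit geo_inverse fps_inverse_power)

lemma divide_one_minus_X: "f / (1 - fps_X) = f * geo"
  using divide_one_minus_X_power[of f 1] by simp

lemma geo_power_nth: "fps_nth (geo ^ Suc k) n = of_nat ((n + k) choose k)"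
proof -
  have "geo ^ Suc k = inverse ((1 - fps_const 1 * fps_X) ^ Suc k)"
    by (simp add: geo_inverse fps_inverse_power del: power_Suc)
  also have "\<dots> = Abs_fps (\<lambda>n. of_nat ((Suc k + n - 1) choose n) * 1 ^ n)"
    by (rule one_minus_const_fps_X_neg_power') simp
  finally show ?thesis
    using binomial_symmetric[of k "n + k"] by (simp add: add.commute)
qed

text \<open>The coefficient \<open>n + k choose k\<close> of \<open>1/(1-x)^(k+1)\<close> is, up to
  the sign \<open>(-1)^k\<close>, the generalised binomial of \<open>-(n+1)\<close> over
  \<open>k\<close>. The Hadamard product thus becomes a product of polynomial values.\<close>

lemma SH_series_nth:
  "fps_nth (geo * subst_poly (- geo) p) n = binomial_eval p (- (of_nat n + 1))"
proof -
  have "geo * subst_poly (- geo) p = (\<Sum>k\<le>degree p. fps_const (coeff p k * (- 1) ^ k) * geo ^ Suc k)"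
  proof -
    have eq: "geo * (fps_const (coeff p k) * (- geo) ^ k) =
        fps_const (coeff p k * (- 1) ^ k) * geo ^ Suc k" for k
      by (cases "even k") (simp_all flip: fps_const_neg)
    show ?thesis
      by (simp only: subst_poly_eq_sum[OF order_refl] sum_distrib_left eq)
  qed
  then have "fps_nth (geo * subst_poly (- geo) p) n =
      (\<Sum>k\<le>degree p. coeff p k * ((- 1) ^ k * of_nat ((n + k) choose k)))"
    by (simp add: fps_sum_nth geo_power_nth mult.assoc del: power_Suc)
  also have "\<dots> = binomial_eval p (- (of_nat n + 1))"
    unfolding binomial_eval_def gbinomial_minus
    by (simp add: binomial_gbinomial algebra_simps)
  finally show ?thesis .
qed

text \<open>For positive \<open>n\<close>, the coefficient in \<open>(x/(1-x))^(k+1)\<close> is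
  \<open>n - 1 choose k\<close>. The constant term is treated apart: truncation of
  \<open>n - 1\<close> would give 1 instead of 0 for \<open>k = 0\<close>.\<close>

lemma lddSH_series_nth:
  "fps_nth (fps_X * geo * subst_poly (fps_X * geo) p) n =
    (if n = 0 then 0 else binomial_eval p (of_nat (n - 1)))"
proof -
  have "fps_nth ((fps_X * geo) ^ Suc k) n = (if n = 0 then 0 else of_nat ((n - 1) choose k))" for k
  proof -
    have "fps_nth ((fps_X * geo) ^ Suc k) n = fps_nth (fps_X ^ Suc k * geo ^ Suc k) n"
      by (simp only: power_mult_distrib)
    also have "\<dots> = (if n < Suc k then 0 else of_nat ((n - Suc k + k) choose k))"
      by (simp only: fps_X_power_mult_nth geo_power_nth)
    also have "\<dots> = (if n = 0 then 0 else of_nat ((n - 1) choose k))"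
      by (cases n) auto
    finally show ?thesis .
  qed
  moreover have "fps_X * geo * subst_poly (fps_X * geo) p =
      (\<Sum>k\<le>degree p. fps_const (coeff p k) * (fps_X * geo) ^ Suc k)"
    by (simp add: subst_poly_eq_sum[OF order_refl] sum_distrib_left mult_ac)
  ultimately show ?thesis
    by (simp add: fps_sum_nth binomial_eval_def binomial_gbinomial del: power_Suc of_nat_diff)
qed

text \<open>Each series has a nonzero coefficient at \<open>fps_X\<close>; this makes evaluating
  polynomials at it injective.\<close>

lemma nonconstant_series:
  "- geo \<noteq> fps_const (fps_nth (- geo) 0)"
  "geo \<noteq> fps_const (fps_nth geo 0)"
  "1 - fps_X \<noteq> fps_const (fps_nth (1 - fps_X :: rat fps) 0)"
  "- (1 - fps_X) \<noteq> fps_const (fps_nth (- (1 - fps_X) :: rat fps) 0)"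
  "fps_X * geo \<noteq> fps_const (fps_nth (fps_X * geo) 0)"
  using geo_power_nth[of 0 0] geo_power_nth[of 0 1]
  by (auto simp: fps_eq_iff intro!: exI[of _ 1])

lemma geo_nonzero: "geo \<noteq> 0"
  using geo_mult by auto

lemma inj_mult_subst_poly:
  assumes "g \<noteq> 0" "w \<noteq> fps_const (fps_nth w 0)"
  shows "inj (\<lambda>p. g * subst_poly w p)"
  using inj_subst_poly[OF assms(2)] assms(1) by (auto simp: inj_def)

section \<open>The change of basis\<close>

lemma lincomb_eq:
  assumes "\<And>k. b k = g * w ^ k"
  shows "lincomb b p = g * subst_poly w p"
  by (simp add: lincomb_def assms subst_poly_eq_sum[OF order_refl] sum_distrib_left mult_ac)

lemma lincomb_SH_basis: "lincomb SH_basis = (\<lambda>p. geo * subst_poly geo p)"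
  by (rule ext, rule lincomb_eq) (simp add: SH_basis_def divide_one_minus_X_power del: power_Suc, simp)

text \<open>The vector of index 0 is the inverse of \<open>1 - fps_X\<close>, that is
  \<open>geo\<close>, so the family is geometric with the same prefactor as
  \<open>SH_basis\<close>.\<close>

lemma lincomb_ddSH_basis: "lincomb ddSH_basis = (\<lambda>p. geo * subst_poly (1 - fps_X) p)"
proof (rule ext, rule lincomb_eq)
  fix k
  show "ddSH_basis k = geo * (1 - fps_X) ^ k"
  proof (cases k)
    case 0
    then show ?thesis
      by (simp add: ddSH_basis_def geo_inverse power_int_minus)
  next
    case (Suc m)
    have "geo * (1 - fps_X) ^ Suc m = (geo * (1 - fps_X)) * (1 - fps_X) ^ m"
      by (simp only: power_Suc mult.assoc)
    then show ?thesis
      by (simp add: ddSH_basis_def Suc geo_mult)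
  qed
qed

text \<open>Passing through coordinates exchanges the substituted \<open>geo\<close> for
  \<open>1 - fps_X\<close>; the coordinates are unique since \<open>geo\<close> is not
  constant.\<close>

lemma psi_eq: "psi (geo * subst_poly geo p) = geo * subst_poly (1 - fps_X) p"
  unfolding psi_def lincomb_SH_basis lincomb_ddSH_basis
  using inv_f_f[OF inj_mult_subst_poly[OF geo_nonzero nonconstant_series(2)]] by simp

text \<open>\<open>psi\<close> is injective on the span because \<open>1 - fps_X\<close> is not
  constant, so its inverse is the opposite exchange.\<close>

lemma psi_inv_eq: "psi_inv (geo * subst_poly (1 - fps_X) p) = geo * subst_poly geo p"
proof -
  have "inj_on psi (range (lincomb SH_basis))"
    using inj_mult_subst_poly[OF geo_nonzero nonconstant_series(3)]
    by (auto simp: inj_on_def lincomb_SH_basis psi_eq dest: injD)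
  then have "psi_inv (psi (geo * subst_poly geo p)) = geo * subst_poly geo p"
    unfolding psi_inv_def by (rule inv_into_f_f) (unfold lincomb_SH_basis, rule rangeI)
  then show ?thesis
    by (simp add: psi_eq)
qed

section \<open>Disjoint union on the three families\<close>

lemma hadamard_SH:
  assumes "coeff r = seq_op op_disj [coeff p, coeff q]"
  shows "(geo * subst_poly (- geo) p) \<odot> (geo * subst_poly (- geo) q) = geo * subst_poly (- geo) r"
  by (rule fps_ext) (simp only: hadamard_def fps_nth_Abs_fps SH_series_nth binomial_eval_mult[OF assms])

lemma hadamard_lddSH:
  assumes "coeff r = seq_op op_disj [coeff p, coeff q]"
  shows "(fps_X * geo * subst_poly (fps_X * geo) p) \<odot> (fps_X * geo * subst_poly (fps_X * geo) q) =
    fps_X * geo * subst_poly (fps_X * geo) r"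
  by (rule fps_ext)
     (simp add: hadamard_def lddSH_series_nth binomial_eval_mult[OF assms] del: of_nat_diff)

text \<open>The sign moves into the polynomials, \<open>psi_inv\<close> exchanges
  \<open>1 - fps_X\<close> for \<open>geo\<close>, and the sign moves back for the Hadamard product;
  the same steps are then reversed.\<close>

lemma ddSH_disj_eq:
  assumes "coeff r = seq_op op_disj [coeff p, coeff q]"
  shows "ddSH_disj (geo * subst_poly (- (1 - fps_X)) p) (geo * subst_poly (- (1 - fps_X)) q) =
    geo * subst_poly (- (1 - fps_X)) r"
  unfolding ddSH_disj_def subst_poly_uminus[of "1 - fps_X", symmetric] psi_inv_eq
  unfolding subst_poly_uminus hadamard_SH[OF assms]
  unfolding subst_poly_uminus[of geo, symmetric] psi_eq
  by (simp only: subst_poly_uminus)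

section \<open>The three families as images of polynomials\<close>

lemma shuffle_series_eq_sum:
  assumes "SP_poset P" "\<And>i. i \<ge> 1 \<Longrightarrow> g * w ^ i = b i"
  shows "g * subst_poly w (shuffle_poly s P) =
    (\<Sum>i = 1..card (Field P). fps_const (s ^ card (Field P) * of_int (d_coeff P i)) * b i)"
proof -
  have fin: "finite (Field P)" and ne: "P \<noteq> {}"
    using assms(1) SP_poset_finite_partial_order[OF assms(1)] by (auto intro: finite_Field)
  have "g * subst_poly w (shuffle_poly s P) =
      (\<Sum>i\<le>card (Field P). fps_const (s ^ card (Field P) * of_int (d_coeff P i)) * (g * w ^ i))"
    by (simp add: subst_poly_eq_sum[OF degree_shuffle_poly[OF fin]] coeff_shuffle_poly[OF fin]
        d_coeff_eq_surj_count[OF fin ne] sum_distrib_left mult_ac)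
  \<comment> \<open>The index 0 contributes nothing for a nonempty poset, so only positive exponents
    have to match \<open>b i\<close>.\<close>
  also have "\<dots> = (\<Sum>i = 1..card (Field P). fps_const (s ^ card (Field P) * of_int (d_coeff P i)) * (g * w ^ i))"
    by (rule sum.mono_neutral_right)
       (auto simp: d_coeff_eq_surj_count[OF fin ne] surj_count_0[OF fin ne] not_less_eq_eq)
  finally show ?thesis
    by (simp add: assms(2))
qed

text \<open>\<open>n - i\<close> and \<open>n + i\<close> have the same parity when the subtraction
  is exact.\<close>

lemma signed_term:
  assumes "i \<le> n"
  shows "fps_const ((- 1) ^ n * of_int a) * ((- 1) ^ i * f) = (- 1) ^ (n - i) * of_int a * (f :: rat fps)"
proof -
  have "fps_const ((- 1) ^ n * of_int a) = ((- 1) ^ n * of_int a :: rat fps)"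
    by (cases "even n") (simp_all add: fps_of_int flip: fps_const_neg)
  moreover have "(- 1) ^ (n - i) = ((- 1) ^ n * (- 1) ^ i :: rat fps)"
    using assms by (metis le_add_diff_inverse2 left_minus_one_mult_self mult.commute power_add)
  ultimately show ?thesis
    by (simp only: mult_ac)
qed

text \<open>The sign is assembled from \<open>(-1)^|P|\<close> in the polynomial and
  \<open>(-1)^i\<close> from \<open>- geo\<close>. For the empty poset the polynomial is 1, and the
  prefactor is the conventional unit.\<close>

lemma SH_eq:
  assumes "SP_or_empty P"
  shows "SH P = geo * subst_poly (- geo) (shuffle_poly (- 1) P)"
proof (cases "P = {}")
  case True
  then show ?thesis
    by (simp add: SH_def shuffle_poly_empty divide_one_minus_X one_pCons)
next
  case False
  then have "SP_poset P"
    using assms by (simp add: SP_or_empty_def)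
  have "geo * (- geo) ^ i = (- 1) ^ i * (1 / (1 - fps_X) ^ (i + 1))" for i
    by (simp only: divide_one_minus_X_power power_minus[of geo]) simp
  from shuffle_series_eq_sum[OF \<open>SP_poset P\<close> this]
  show ?thesis
    by (simp only: SH_def False if_False) (intro sum.cong refl signed_term[symmetric], simp)
qed

text \<open>The prefactor \<open>geo\<close> lowers each positive power of \<open>1 - fps_X\<close>
  by one, giving the exponent \<open>i - 1\<close>.\<close>

lemma ddSH_eq:
  assumes "SP_or_empty P"
  shows "ddSH P = geo * subst_poly (- (1 - fps_X)) (shuffle_poly (- 1) P)"
proof (cases "P = {}")
  case True
  then show ?thesis
    by (simp add: ddSH_def shuffle_poly_empty divide_one_minus_X one_pCons)
next
  case False
  then have "SP_poset P"
    using assms by (simp add: SP_or_empty_def)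
  have "geo * (- (1 - fps_X)) ^ i = (- 1) ^ i * (1 - fps_X) ^ (i - 1)" if "i \<ge> 1" for i
  proof -
    from \<open>i \<ge> 1\<close> obtain m where m: "i = Suc m"
      by (cases i) auto
    have "(- (1 - fps_X)) ^ i = (- 1) ^ i * ((1 - fps_X) * (1 - fps_X :: rat fps) ^ m)"
      by (subst power_minus) (simp only: m power_Suc)
    then have "geo * (- (1 - fps_X)) ^ i = (- 1) ^ i * ((geo * (1 - fps_X)) * (1 - fps_X) ^ m)"
      by (simp only: mult_ac)
    then show ?thesis
      by (simp add: geo_mult m)
  qed
  from shuffle_series_eq_sum[OF \<open>SP_poset P\<close> this]
  show ?thesis
    by (simp only: ddSH_def False if_False) (intro sum.cong refl signed_term[symmetric], simp)
qed

lemma lddSH_eq: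
  assumes "SP_or_empty P"
  shows "lddSH P = fps_X * geo * subst_poly (fps_X * geo) (shuffle_poly 1 P)"
proof (cases "P = {}")
  case True
  then show ?thesis
    by (simp add: lddSH_def shuffle_poly_empty divide_one_minus_X one_pCons)
next
  case False
  then have "SP_poset P"
    using assms by (simp add: SP_or_empty_def)
  have "fps_X * geo * (fps_X * geo) ^ i = fps_X ^ (i + 1) / (1 - fps_X) ^ (i + 1)" for i
    unfolding divide_one_minus_X_power power_mult_distrib[symmetric] by simp
  from shuffle_series_eq_sum[OF \<open>SP_poset P\<close> this]
  show ?thesis
    using False by (simp add: lddSH_def fps_of_int)
qed

text \<open>The factor \<open>1 - fps_X\<close> cancels one of the two prefactors
  \<open>geo\<close>.\<close>

lemma SH_ord_eq: "SH_ord (geo * subst_poly w p) (geo * subst_poly w q) = geo * subst_poly w (p * q)"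
proof -
  have "SH_ord (geo * subst_poly w p) (geo * subst_poly w q) =
      (geo * (1 - fps_X)) * (geo * (subst_poly w p * subst_poly w q))"
    by (simp only: SH_ord_def mult_ac)
  then show ?thesis
    by (simp add: geo_mult subst_poly_mult)
qed

text \<open>One of the two prefactors \<open>x/(1-x)\<close> cancels against \<open>(1-x)/x\<close>;
  the dividend is a multiple of \<open>fps_X\<close>, so the division is exact.\<close>

lemma lddSH_ord_eq:
  "lddSH_ord (fps_X * geo * subst_poly w p) (fps_X * geo * subst_poly w q) =
    fps_X * geo * subst_poly w (p * q)"
proof -
  have "fps_X * geo * subst_poly w p * (1 - fps_X) * (fps_X * geo * subst_poly w q) =
      fps_X * ((geo * (1 - fps_X)) * (fps_X * geo * (subst_poly w p * subst_poly w q)))"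
    by (simp only: mult_ac)
  then show ?thesis
    unfolding lddSH_ord_def
    by (simp only: geo_mult mult_1 subst_poly_mult nonzero_mult_div_cancel_left[OF fps_X_neq_zero])
qed

theorem lemma3p15:
  shows
    "SP_series_algebra (SH :: 'a::infinite rel \<Rightarrow> rat fps)
       (1 / (1 - fps_X) ^ 2) (1 / (1 - fps_X)) hadamard SH_ord \<and>
     SP_series_algebra (ddSH :: 'a rel \<Rightarrow> rat fps)
       1 (1 / (1 - fps_X)) ddSH_disj SH_ord \<and>
     SP_series_algebra (lddSH :: 'a rel \<Rightarrow> rat fps)
       (fps_X ^ 2 / (1 - fps_X) ^ 2) (fps_X / (1 - fps_X)) hadamard lddSH_ord"
proof (intro conjI)
  \<comment> \<open>The generator has polynomial \<open>-x\<close>; its sign cancels against that of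
    \<open>- geo\<close>, leaving \<open>geo ^ 2\<close>.\<close>
  have "SP_series_algebra (SH :: 'a rel \<Rightarrow> rat fps) (geo * subst_poly (- geo) [:0, - 1:])
      (geo * subst_poly (- geo) 1) hadamard SH_ord"
    by (rule SP_series_algebraI[where h = "\<lambda>p. geo * subst_poly (- geo) p"])
       (rule inj_mult_subst_poly geo_nonzero nonconstant_series SH_eq hadamard_SH SH_ord_eq; assumption?)+
  moreover have "geo * subst_poly (- geo) [:0, - 1:] = 1 / (1 - fps_X) ^ 2"
    unfolding divide_one_minus_X_power by (simp add: power2_eq_square flip: fps_const_neg)
  ultimately show "SP_series_algebra (SH :: 'a rel \<Rightarrow> rat fps)
       (1 / (1 - fps_X) ^ 2) (1 / (1 - fps_X)) hadamard SH_ord"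
    by (simp add: one_pCons divide_one_minus_X)
  \<comment> \<open>Here the signs cancel likewise, and on the generator \<open>1 - fps_X\<close>
    cancels the prefactor.\<close>
  have "SP_series_algebra (ddSH :: 'a rel \<Rightarrow> rat fps) (geo * subst_poly (- (1 - fps_X)) [:0, - 1:])
      (geo * subst_poly (- (1 - fps_X)) 1) ddSH_disj SH_ord"
    by (rule SP_series_algebraI[where h = "\<lambda>p. geo * subst_poly (- (1 - fps_X)) p"])
       (rule inj_mult_subst_poly geo_nonzero nonconstant_series ddSH_eq ddSH_disj_eq SH_ord_eq; assumption?)+
  moreover have "geo * subst_poly (- (1 - fps_X)) [:0, - 1:] = geo * (1 - fps_X)"
    by (simp flip: fps_const_neg)
  ultimately show "SP_series_algebra (ddSH :: 'a rel \<Rightarrow> rat fps)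
       1 (1 / (1 - fps_X)) ddSH_disj SH_ord"
    by (simp only: geo_mult) (simp add: one_pCons divide_one_minus_X)
  \<comment> \<open>The defining sum is unsigned, so \<open>s = 1\<close>, and
    \<open>fps_X * geo\<close> is both prefactor and substituted series.\<close>
  have "SP_series_algebra (lddSH :: 'a rel \<Rightarrow> rat fps) (fps_X * geo * subst_poly (fps_X * geo) [:0, 1:])
      (fps_X * geo * subst_poly (fps_X * geo) 1) hadamard lddSH_ord"
    by (rule SP_series_algebraI[where h = "\<lambda>p. fps_X * geo * subst_poly (fps_X * geo) p"])
       (rule inj_mult_subst_poly nonconstant_series lddSH_eq hadamard_lddSH lddSH_ord_eq
          | assumption | simp add: geo_nonzero)+
  moreover have "fps_X * geo * subst_poly (fps_X * geo) [:0, 1:] = fps_X ^ 2 / (1 - fps_X) ^ 2"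
    unfolding divide_one_minus_X_power by (simp add: power2_eq_square mult_ac)
  ultimately show "SP_series_algebra (lddSH :: 'a rel \<Rightarrow> rat fps)
       (fps_X ^ 2 / (1 - fps_X) ^ 2) (fps_X / (1 - fps_X)) hadamard lddSH_ord"
    by (simp add: one_pCons divide_one_minus_X)
qed

end
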